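(* Let $1\le p<\infty$, let $\mu$ and $\nu$ be Radon measures on $I$ and $J$ respectively, and let $T=(T^t)_{t\in J}$ be a translation on $L^p_\mu(I)$ that is bounded, i.e. $M_T:=\sup_{t\in J}\sup_{\|f\|_{\mu,p}\le 1}\|T^tf\|_{\mu,p}<\infty$, and that is regular with respect to $p,\mu,\nu$. Let $K\subset L^p_\mu(I)$ be a bounded set. Then $K$ is precompact in $L^p_\mu(I)$ if and only if $K$ is equivanishing and equicontinuous in mean.
   Context: Setting. $I\subset\mathbb{R}^d$; $J\subset[0,\infty)$ is an interval of positive length with left endpoint $0\in J$. $\|f\|_{\mu,p}=\left(\int_I|f|^p\,d\mu\right)^{1/p}$. For $R>0$ put $B_R=\{x\in I:\|x\|\le R\}$ (in $I$) and for $a>0$ put $B_a=(-a,a)\cap J$ (in $J$). The Radon measures $\mu$ on $I$, $\nu$ on $J$ are finite on bounded sets, and $A:=\nu(B_a)>0$ for every $a>0$. Translation. A translation is a family of linear operators $f\mapsto T^tf$, $T^tf(x)=u(x,t)$, where $u$ is the solution of a problem $Lu=0$ on $I\times J$, $u(x,0)=f(x)$ on $I$; here $L$ is a linear partial differential operator of order at most two, $f\in L^p_\mu(I)$, and the initial condition is understood in the $L^p_\mu$ norm. $T^0f=f$. It is understood that $T^tf(x)$ is jointly measurable in $(x,t)$ and the averages below are well defined. For $a,R>0$, $$M_{a,R}f(x)=\frac1A\int_{B_a}T^tf(x)\,d\nu(t)\ \text{ if } |x|<R,\qquad M_{a,R}f(x)=0\ \text{ if } |x|\ge R .$$ Regularity.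 $T$ is regular with respect to $p,\mu,\nu$ if: (T1) there is a dense set $\mathcal{E}_1\subset L^p_\mu(I)$ such that for all $g\in\mathcal{E}_1$, $M_0>0$, $\varepsilon>0$ there is $\delta=\delta(\varepsilon,M_0,g)>0$ such that for all $0<t<M_0$ and $|h|\le\delta$ (with $t,t+h\in J$), $\|T^{t+h}g-T^tg\|_{\mu,p}<\varepsilon$; (T2) there is a dense set $\mathcal{E}_2\subset L^p_\mu(I)$ such that for all $g\in\mathcal{E}_2$ and $\varepsilon,a,R>0$ there is $\delta=\delta(g,\varepsilon,a,R)>0$ such that $|M_{a,R}g(x+h)-M_{a,R}g(x)|<\varepsilon$ whenever $|h|\le\delta$ and $x,x+h\in I$ with $|x|,|x+h|<R$; (T3) for all $a,R>0$ there is a finite constant $c(a,R)$ such that $|M_{a,R}f(x)|\le c(a,R)\|f\|_{\mu,p}$ for all $f\in L^p_\mu(I)$ and all $x\in I$. Properties of sets. $K\subset L^p_\mu(I)$ is equivanishing (property $\mathbf{P_a}$) if for all $\varepsilon>0$ there is $R>0$ such that $\left(\int_{I\setminus B_R}|f|^p\,d\mu\right)^{1/p}<\varepsilon$ for all $f\in K$. $K$ is equicontinuous in mean if it satisfies both: $\mathbf{P_{b_1}}$: for all $\varepsilon,M_0>0$ there is $\delta>0$ such that $\|T^{t+h}f-T^tf\|_{\mu,p}<\varepsilon$ for all $t\in B_{M_0}$, $|h|\le\delta$ with $t+h\in J$, and all $f\in K$; $\mathbf{P_{b_2}}$: for all $\varepsilon,a,R>0$ there is $\delta>0$ such that $|M_{a,R}f(x+h)-M_{a,R}f(x)|<\varepsilon$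 for all $|h|\le\delta$, all $x,x+h\in I$ with $|x|,|x+h|<R$, and all $f\in K$. *)

theory Defs
  imports "HOL-Analysis.Analysis"
begin

text \<open>
  Functions take values in \<^typ>\<open>'b\<close> of sort real normed field and Euclidean space, which covers
  the real and the complex scalars; linearity is linearity over \<^typ>\<open>'b\<close>.
  The ambient space of \<open>I\<close> is an arbitrary Euclidean space \<^typ>\<open>'a\<close>.
\<close>

section \<open>Radon measures\<close>

definition radon_measure_on :: "'a::euclidean_space set \<Rightarrow> 'a measure \<Rightarrow> bool" where
  "radon_measure_on X M \<longleftrightarrow>
     sets M = sets (restrict_space borel X) \<and>
     (\<forall>C. compact C \<and> C \<subseteq> X \<longrightarrow> emeasure M C < \<infinity>) \<and>
     (\<forall>E\<in>sets M. emeasure M E = (SUP C\<in>{C. compact C \<and> C \<subseteq> E}. emeasure M C))"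

definition finite_on_bounded :: "'a::euclidean_space measure \<Rightarrow> bool" where
  "finite_on_bounded M \<longleftrightarrow> (\<forall>E\<in>sets M. bounded E \<longrightarrow> emeasure M E < \<infinity>)"


section \<open>The space \<open>L\<^sup>p\<close>\<close>

definition Lp :: "'a measure \<Rightarrow> real \<Rightarrow> ('a \<Rightarrow> 'b::euclidean_space) set" where
  "Lp M p = {f \<in> borel_measurable M. integrable M (\<lambda>x. norm (f x) powr p)}"

definition Lp_norm :: "'a measure \<Rightarrow> real \<Rightarrow> ('a \<Rightarrow> 'b::euclidean_space) \<Rightarrow> real" where
  "Lp_norm M p f = (LINT x|M. norm (f x) powr p) powr (1 / p)"

definition Lp_dense :: "'a measure \<Rightarrow> real \<Rightarrow> ('a \<Rightarrow> 'b::euclidean_space) set \<Rightarrow> bool" where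
  "Lp_dense M p E \<longleftrightarrow>
     E \<subseteq> Lp M p \<and> (\<forall>f\<in>Lp M p. \<forall>\<epsilon>>0. \<exists>g\<in>E. Lp_norm M p (\<lambda>x. f x - g x) < \<epsilon>)"

text \<open>
  The elements of \<^term>\<open>Lp M p\<close> are functions. The metric space is made of their classes
  modulo equality almost everywhere; precompactness (relative compactness) is taken there.
\<close>

definition Lp_class :: "'a measure \<Rightarrow> real \<Rightarrow> ('a \<Rightarrow> 'b::euclidean_space) \<Rightarrow> ('a \<Rightarrow> 'b) set" where
  "Lp_class M p f = {g \<in> Lp M p. AE x in M. g x = f x}"

definition Lp_space :: "'a measure \<Rightarrow> real \<Rightarrow> ('a \<Rightarrow> 'b::euclidean_space) set set" where
  "Lp_space M p = Lp_class M p ` Lp M p"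

definition Lp_dist ::
  "'a measure \<Rightarrow> real \<Rightarrow> ('a \<Rightarrow> 'b::euclidean_space) set \<Rightarrow> ('a \<Rightarrow> 'b) set \<Rightarrow> real" where
  "Lp_dist M p F G = Lp_norm M p (\<lambda>x. (SOME f. f \<in> F) x - (SOME g. g \<in> G) x)"

definition Lp_topology :: "'a measure \<Rightarrow> real \<Rightarrow> ('a \<Rightarrow> 'b::euclidean_space) set topology" where
  "Lp_topology M p = Metric_space.mtopology (Lp_space M p) (Lp_dist M p)"

definition Lp_precompact :: "'a measure \<Rightarrow> real \<Rightarrow> ('a \<Rightarrow> 'b::euclidean_space) set \<Rightarrow> bool" where
  "Lp_precompact M p K \<longleftrightarrow>
     compactin (Lp_topology M p) (Lp_topology M p closure_of (Lp_class M p ` K))"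

definition Lp_bounded :: "'a measure \<Rightarrow> real \<Rightarrow> ('a \<Rightarrow> 'b::euclidean_space) set \<Rightarrow> bool" where
  "Lp_bounded M p K \<longleftrightarrow> (\<exists>C. \<forall>f\<in>K. Lp_norm M p f \<le> C)"


section \<open>Linear partial differential operators\<close>

definition partial_deriv ::
  "'c::euclidean_space \<Rightarrow> ('c \<Rightarrow> 'b::real_normed_vector) \<Rightarrow> 'c \<Rightarrow> 'b" where
  "partial_deriv i u z = vector_derivative (\<lambda>s. u (z + s *\<^sub>R i)) (at 0)"

text \<open>Continuously differentiable of order \<open>k\<close> on an open set.\<close>

fun Ck_on :: "nat \<Rightarrow> 'c::euclidean_space set \<Rightarrow> ('c \<Rightarrow> 'b::real_normed_vector) \<Rightarrow> bool" where
  "Ck_on 0 S u \<longleftrightarrow> continuous_on S u"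
| "Ck_on (Suc k) S u \<longleftrightarrow>
     continuous_on S u \<and>
     (\<forall>i\<in>Basis. (\<forall>z\<in>S. (\<lambda>s::real. u (z + s *\<^sub>R i)) differentiable at 0) \<and>
                Ck_on k S (partial_deriv i u))"

text \<open>
  The operator of order at most \<open>k\<close> with coefficient functions \<open>c\<close>. A word \<open>[i\<^sub>1, \<dots>, i\<^sub>m]\<close> over
  the basis, \<open>m \<le> k\<close>, indexes the iterated partial derivative in these directions.
\<close>

definition linear_pdo ::
  "nat \<Rightarrow> ('c::euclidean_space list \<Rightarrow> 'c \<Rightarrow> 'b) \<Rightarrow> ('c \<Rightarrow> 'b::real_normed_field) \<Rightarrow> 'c \<Rightarrow> 'b" where
  "linear_pdo k c u z =
     (\<Sum>\<alpha> | set \<alpha> \<subseteq> Basis \<and> length \<alpha> \<le> k. c \<alpha> z * foldr partial_deriv \<alpha> u z)"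

definition classical_solution ::
  "nat \<Rightarrow> ('c::euclidean_space list \<Rightarrow> 'c \<Rightarrow> 'b) \<Rightarrow> 'c set \<Rightarrow> ('c \<Rightarrow> 'b::real_normed_field) \<Rightarrow> bool" where
  "classical_solution k c S u \<longleftrightarrow> Ck_on k S u \<and> (\<forall>z\<in>S. linear_pdo k c u z = 0)"

text \<open>
  For arbitrary initial data in \<open>L\<^sup>p\<close> a solution \<open>u\<close> of \<open>L u = 0\<close> need not be differentiable, so
  solutions are understood in the generalized sense: for every \<open>t\<close>, \<open>u(\<cdot>, t)\<close> is the limit in
  \<open>L\<^sup>p\<close> of one sequence of classical solutions (a classical solution qualifies by the constant sequence).
  Space and time together range over \<open>I \<times> J\<close>; derivatives are taken in its interior.
\<close>

definition generalized_solution ::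
  "nat \<Rightarrow> (('a::euclidean_space \<times> real) list \<Rightarrow> 'a \<times> real \<Rightarrow> 'b) \<Rightarrow> 'a set \<Rightarrow> real set \<Rightarrow>
   'a measure \<Rightarrow> real \<Rightarrow> ('a \<Rightarrow> real \<Rightarrow> 'b::{real_normed_field,euclidean_space}) \<Rightarrow> bool" where
  "generalized_solution k c I J \<mu> p u \<longleftrightarrow>
     (\<exists>v. (\<forall>n::nat. classical_solution k c (interior (I \<times> J)) (v n)) \<and>
          (\<forall>t\<in>J. (\<forall>n. (\<lambda>x. v n (x, t)) \<in> Lp \<mu> p) \<and>
                 (\<lambda>n. Lp_norm \<mu> p (\<lambda>x. v n (x, t) - u x t)) \<longlonglongrightarrow> 0))"


section \<open>Translations and their averages\<close>

definition avg ::
  "real set \<Rightarrow> real measure \<Rightarrow> (real \<Rightarrow> ('a::euclidean_space \<Rightarrow> 'b) \<Rightarrow> 'a \<Rightarrow> 'b) \<Rightarrow> real \<Rightarrow> real \<Rightarrow>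
   ('a \<Rightarrow> 'b::{real_normed_field,euclidean_space}) \<Rightarrow> 'a \<Rightarrow> 'b" where
  "avg J \<nu> T a R f x =
     (if norm x < R
      then (1 / measure \<nu> ({-a<..<a} \<inter> J)) *\<^sub>R (LINT t:({-a<..<a} \<inter> J)|\<nu>. T t f x)
      else 0)"

text \<open>
  \<^term>\<open>T t f\<close> is a function defined at every point, since the averages are evaluated pointwise.
  The second form of linearity, at a fixed point \<open>x\<close> and for almost every \<open>t\<close>, says that
  linearity is inherited by the averages at every point; the integrability clause says that the
  averages exist at every point. The linearity of each \<open>T\<^sup>t\<close> as an operator on \<open>L\<^sup>p\<close> is the first form.
\<close>

definition translation ::
  "'a::euclidean_space set \<Rightarrow> real set \<Rightarrow> real \<Rightarrow> 'a measure \<Rightarrow> real measure \<Rightarrow>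
   (real \<Rightarrow> ('a \<Rightarrow> 'b) \<Rightarrow> 'a \<Rightarrow> 'b::{real_normed_field,euclidean_space}) \<Rightarrow> bool" where
  "translation I J p \<mu> \<nu> T \<longleftrightarrow>
     (\<forall>t\<in>J. \<forall>f\<in>Lp \<mu> p. T t f \<in> Lp \<mu> p) \<and>
     (\<forall>t\<in>J. \<forall>f\<in>Lp \<mu> p. \<forall>g\<in>Lp \<mu> p. (AE x in \<mu>. f x = g x) \<longrightarrow> (AE x in \<mu>. T t f x = T t g x)) \<and>
     (\<forall>f\<in>Lp \<mu> p. \<forall>g\<in>Lp \<mu> p. \<forall>c.
        (\<forall>t\<in>J. AE x in \<mu>. T t (\<lambda>y. c * f y + g y) x = c * T t f x + T t g x) \<and>
        (\<forall>x\<in>I. AE t in \<nu>. T t (\<lambda>y. c * f y + g y) x = c * T t f x + T t g x)) \<and>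
     (\<exists>k\<le>2. \<exists>c. \<forall>f\<in>Lp \<mu> p. generalized_solution k c I J \<mu> p (\<lambda>x t. T t f x)) \<and>
     (\<forall>f\<in>Lp \<mu> p. Lp_norm \<mu> p (\<lambda>x. T 0 f x - f x) = 0 \<and>
        ((\<lambda>t. Lp_norm \<mu> p (\<lambda>x. T t f x - f x)) \<longlongrightarrow> 0) (at 0 within J)) \<and>
     (\<forall>f\<in>Lp \<mu> p. (\<lambda>(x, t). T t f x) \<in> borel_measurable (\<mu> \<Otimes>\<^sub>M \<nu>)) \<and>
     (\<forall>f\<in>Lp \<mu> p. \<forall>a>0. \<forall>x\<in>I. set_integrable \<nu> ({-a<..<a} \<inter> J) (\<lambda>t. T t f x))"

definition bounded_translation ::
  "real set \<Rightarrow> real \<Rightarrow> 'a::euclidean_space measure \<Rightarrow>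
   (real \<Rightarrow> ('a \<Rightarrow> 'b) \<Rightarrow> 'a \<Rightarrow> 'b::{real_normed_field,euclidean_space}) \<Rightarrow> bool" where
  "bounded_translation J p \<mu> T \<longleftrightarrow>
     bdd_above {Lp_norm \<mu> p (T t f) |t f. t \<in> J \<and> f \<in> Lp \<mu> p \<and> Lp_norm \<mu> p f \<le> 1}"

definition regular_translation ::
  "'a::euclidean_space set \<Rightarrow> real set \<Rightarrow> real \<Rightarrow> 'a measure \<Rightarrow> real measure \<Rightarrow>
   (real \<Rightarrow> ('a \<Rightarrow> 'b) \<Rightarrow> 'a \<Rightarrow> 'b::{real_normed_field,euclidean_space}) \<Rightarrow> bool" where
  "regular_translation I J p \<mu> \<nu> T \<longleftrightarrow>
     (\<exists>E. Lp_dense \<mu> p E \<and>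
        (\<forall>g\<in>E. \<forall>M>0. \<forall>\<epsilon>>0. \<exists>\<delta>>0. \<forall>t h.
           0 < t \<and> t < M \<and> \<bar>h\<bar> \<le> \<delta> \<and> t \<in> J \<and> t + h \<in> J \<longrightarrow>
           Lp_norm \<mu> p (\<lambda>x. T (t + h) g x - T t g x) < \<epsilon>)) \<and>
     (\<exists>E. Lp_dense \<mu> p E \<and>
        (\<forall>g\<in>E. \<forall>\<epsilon>>0. \<forall>a>0. \<forall>R>0. \<exists>\<delta>>0. \<forall>x h.
           norm h \<le> \<delta> \<and> x \<in> I \<and> x + h \<in> I \<and> norm x < R \<and> norm (x + h) < R \<longrightarrow>
           norm (avg J \<nu> T a R g (x + h) - avg J \<nu> T a R g x) < \<epsilon>)) \<and>
     (\<forall>a>0. \<forall>R>0. \<exists>C. \<forall>f\<in>Lp \<mu> p. \<forall>x\<in>I. norm (avg J \<nu> T a R f x) \<le> C * Lp_norm \<mu> p f)"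


section \<open>Equivanishing and equicontinuity in mean\<close>

definition equivanishing ::
  "'a::euclidean_space set \<Rightarrow> real \<Rightarrow> 'a measure \<Rightarrow> ('a \<Rightarrow> 'b::euclidean_space) set \<Rightarrow> bool" where
  "equivanishing I p \<mu> K \<longleftrightarrow>
     (\<forall>\<epsilon>>0. \<exists>R>0. \<forall>f\<in>K.
        (LINT x:(I - {x\<in>I. norm x \<le> R})|\<mu>. norm (f x) powr p) powr (1 / p) < \<epsilon>)"

definition equicontinuous_in_mean ::
  "'a::euclidean_space set \<Rightarrow> real set \<Rightarrow> real \<Rightarrow> 'a measure \<Rightarrow> real measure \<Rightarrow>
   (real \<Rightarrow> ('a \<Rightarrow> 'b) \<Rightarrow> 'a \<Rightarrow> 'b::{real_normed_field,euclidean_space}) \<Rightarrow>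
   ('a \<Rightarrow> 'b) set \<Rightarrow> bool" where
  "equicontinuous_in_mean I J p \<mu> \<nu> T K \<longleftrightarrow>
     (\<forall>\<epsilon>>0. \<forall>M>0. \<exists>\<delta>>0. \<forall>t\<in>{-M<..<M} \<inter> J. \<forall>h. \<forall>f\<in>K.
        \<bar>h\<bar> \<le> \<delta> \<and> t + h \<in> J \<longrightarrow> Lp_norm \<mu> p (\<lambda>x. T (t + h) f x - T t f x) < \<epsilon>) \<and>
     (\<forall>\<epsilon>>0. \<forall>a>0. \<forall>R>0. \<exists>\<delta>>0. \<forall>x h. \<forall>f\<in>K.
        norm h \<le> \<delta> \<and> x \<in> I \<and> x + h \<in> I \<and> norm x < R \<and> norm (x + h) < R \<longrightarrow>
        norm (avg J \<nu> T a R f (x + h) - avg J \<nu> T a R f x) < \<epsilon>)"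

end

(*
  Total boundedness is transported through the averages M f = M_{a,R} f.  If K is precompact, finite
  epsilon-nets together with the bounds on T^t and on M reduce every property to finitely many
  functions, and those are handled by density and (T1), (T2).  Conversely, Jensen's inequality and
  Tonelli give ||M f - f||_p <= sup_{t in B_a} ||T^t f - f||_p + (tail of f beyond R), which is small
  uniformly on K for small a and large R; for such a and R the functions M f, f in K, are uniformly
  bounded by (T3) and uniformly equicontinuous on the bounded set {|x| < R}, so an Arzela-Ascoli
  argument gives a finite net in the uniform norm, hence in L^p since mu is finite there.
  Completeness of L^p turns finite nets into precompactness.
*)
theory Submission
  imports Defs
begin

section \<open>The space \<open>L\<^sup>p\<close>\<close>

text \<open>For ordinary shifts, averages over a ball inherit equicontinuity in \<open>x\<close>
  from the continuity of the shift in the L^p norm. Here the parameter \<open>t\<close> bears no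
  relation to the position \<open>x\<close>, so continuity of \<open>T t f\<close> in
  \<open>t\<close> says nothing about the averages as functions of \<open>x\<close>. Hence
  equicontinuity in mean has two halves, with separate tasks: the first brings \<open>f\<close>
  close to its average, the second supplies the net for the averages.

  The estimates live on two levels. Norms see functions only up to null sets, whereas averages are
  compared at single points. Arguments on \<open>T t\<close> use linearity at a fixed time for
  almost every point; arguments on averages use linearity at a fixed point for almost every
  time.\<close>

text \<open>The supporting line of a convex power. Minkowski's inequality and Jensen's inequality
  below are both integrated forms of it.\<close>

lemma powr_above_tangent:
  fixes m u p :: real
  assumes "1 \<le> p" "0 \<le> u" "0 < m"
  shows "m powr p + p * m powr (p - 1) * (u - m) \<le> u powr p"
\<comment> \<open>Convexity and the derivative are used on the open half-line, so
  \<open>u = 0\<close> is separate: the tangent has the value (1 - p) m^p there, which is at most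
  0.\<close>
proof (cases "u = 0")
  case True
  have "m powr (p - 1) * m = m powr p"
    using assms by (simp add: powr_mult_base mult.commute)
  then have "m powr p + p * m powr (p - 1) * (u - m) = (1 - p) * m powr p"
    using True by (simp add: algebra_simps)
  also have "\<dots> \<le> 0"
    using assms by (intro mult_nonpos_nonneg) auto
  finally show ?thesis
    using True by simp
next
  case False
  have "(p * m powr (p - 1)) * (u - m) \<le> u powr p - m powr p"
  proof (rule convex_on_imp_above_tangent[where A = "{0<..}"])
    show "((\<lambda>x. x powr p) has_real_derivative p * m powr (p - 1)) (at m within {0<..})"
      using assms by (auto intro!: derivative_eq_intros)
  qed (use assms False in \<open>auto simp: powr_convex interior_open\<close>)
  then show ?thesis
    by linarith
qed

text \<open>Convexity at the points \<open>u / a\<close> and \<open>v / b\<close> with weights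
  a/(a+b) and b/(a+b). When the p-th powers of \<open>u\<close> and \<open>v\<close> have integrals
  at most a^p and b^p, the right-hand side integrates to at most (a+b)^p, which is Minkowski's
  inequality.\<close>

lemma powr_add_le_weighted:
  fixes a b u v p :: real
  assumes "1 \<le> p" "0 < a" "0 < b" "0 \<le> u" "0 \<le> v"
  shows "(u + v) powr p \<le>
    (a + b) powr (p - 1) * a / a powr p * u powr p + (a + b) powr (p - 1) * b / b powr p * v powr p"
proof (cases "u + v = 0")
  case True
  then show ?thesis using assms by auto
next
  case False
  define m where "m = (u + v) / (a + b)"
  have m: "0 < m" using False assms by (auto simp: m_def)
  have ba: "(a + b) powr p = (a + b) powr (p - 1) * (a + b)"
    using assms by (simp add: powr_mult_base mult.commute)
  have 1: "m powr p + p * m powr (p - 1) * (u / a - m) \<le> (u / a) powr p"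
    and 2: "m powr p + p * m powr (p - 1) * (v / b - m) \<le> (v / b) powr p"
    using assms m by (auto intro!: powr_above_tangent)
  \<comment> \<open>\<open>m\<close> is the weighted mean of the two points, so the linear terms of
    the two tangents cancel.\<close>
  have "a * (u / a - m) + b * (v / b - m) = (u + v) - (a + b) * m"
    using assms by (simp add: algebra_simps)
  also have "\<dots> = 0"
    using assms by (simp add: m_def)
  finally have "a * (u / a - m) + b * (v / b - m) = 0" .
  then have "p * m powr (p - 1) * (a * (u / a - m) + b * (v / b - m)) = 0"
    by simp
  then have "(a + b) * m powr p =
      a * (m powr p + p * m powr (p - 1) * (u / a - m)) + b * (m powr p + p * m powr (p - 1) * (v / b - m))"
    by (simp only: distrib_left distrib_right mult.left_commute mult.commute)
  also have "\<dots> \<le> a * (u / a) powr p + b * (v / b) powr p"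
    using 1 2 assms by (intro add_mono mult_left_mono) auto
  finally have "(a + b) powr (p - 1) * ((a + b) * m powr p)
      \<le> (a + b) powr (p - 1) * (a * (u / a) powr p + b * (v / b) powr p)"
    by (intro mult_left_mono) auto
  moreover have "(a + b) powr (p - 1) * ((a + b) * m powr p) = (u + v) powr p"
    using assms False ba by (simp add: m_def powr_divide)
  ultimately show ?thesis
    using assms by (simp add: powr_divide algebra_simps)
qed

section \<open>Norm calculus and Minkowski's inequality\<close>

lemma Lp_norm_nonneg [simp]: "0 \<le> Lp_norm M p f"
  by (simp add: Lp_norm_def)

lemma Lp_measurable: "f \<in> Lp M p \<Longrightarrow> f \<in> borel_measurable M"
  by (simp add: Lp_def)

lemma nn_integral_Lp:
  assumes "f \<in> Lp M p" "0 < p"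
  shows "(\<integral>\<^sup>+x. ennreal (norm (f x) powr p) \<partial>M) = ennreal (Lp_norm M p f powr p)"
proof -
  have "0 \<le> (LINT x|M. norm (f x) powr p)"
    by simp
  then have "Lp_norm M p f powr p = (LINT x|M. norm (f x) powr p)"
    using assms by (simp add: Lp_norm_def powr_powr)
  then show ?thesis
    using assms by (simp add: Lp_def nn_integral_eq_integral)
qed

text \<open>A bound on the extended-valued integral gives membership and the norm estimate together,
  so later estimates need no separate proof of integrability.\<close>

lemma
  assumes f: "f \<in> borel_measurable M" and p: "0 < p" and c: "0 \<le> c"
    and le: "(\<integral>\<^sup>+x. ennreal (norm (f x) powr p) \<partial>M) \<le> ennreal (c powr p)"
  shows Lp_I: "f \<in> Lp M p" and Lp_norm_leI: "Lp_norm M p f \<le> c"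
proof -
  have "(\<lambda>x. norm (f x) powr p) \<in> borel_measurable M"
    using f by simp
  moreover have "(\<integral>\<^sup>+x. ennreal (norm (f x) powr p) \<partial>M) < \<infinity>"
    using le by (rule order.strict_trans1) simp
  ultimately show *: "f \<in> Lp M p"
    using f by (auto simp: Lp_def intro!: integrableI_nonneg)
  have "Lp_norm M p f powr p \<le> c powr p"
    using le nn_integral_Lp[OF * p] by simp
  then show "Lp_norm M p f \<le> c"
    using p c by (smt (verit) Lp_norm_nonneg powr_less_mono2)
qed

lemma
  assumes p: "1 \<le> p" and f: "f \<in> Lp M p" and g: "g \<in> Lp M p"
  shows Lp_add: "(\<lambda>x. f x + g x) \<in> Lp M p"
    and Lp_norm_triangle: "Lp_norm M p (\<lambda>x. f x + g x) \<le> Lp_norm M p f + Lp_norm M p g"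
proof -
  have [measurable]: "f \<in> borel_measurable M" "g \<in> borel_measurable M"
    using f g by (auto simp: Lp_def)
  \<comment> \<open>Strict upper bounds \<open>a\<close> and \<open>b\<close> are positive even if a
    norm is 0, so the weights make sense. The excess is 1 for membership and tends to 0 for the norm
    estimate.\<close>
  have *: "(\<integral>\<^sup>+x. ennreal (norm (f x + g x) powr p) \<partial>M) \<le> ennreal ((a + b) powr p)"
    if a: "Lp_norm M p f < a" and b: "Lp_norm M p g < b" for a b
  proof -
    have pos: "0 < a" "0 < b"
      using a b Lp_norm_nonneg by (metis order.strict_trans1)+
    define s where "s = (a + b) powr (p - 1) * a / a powr p"
    define t where "t = (a + b) powr (p - 1) * b / b powr p"
    have st: "0 \<le> s" "0 \<le> t"
      using pos by (auto simp: s_def t_def)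
    have "(\<integral>\<^sup>+x. ennreal (norm (f x + g x) powr p) \<partial>M)
        \<le> (\<integral>\<^sup>+x. ennreal s * ennreal (norm (f x) powr p) + ennreal t * ennreal (norm (g x) powr p) \<partial>M)"
    proof (rule nn_integral_mono)
      fix x
      have "norm (f x + g x) powr p \<le> (norm (f x) + norm (g x)) powr p"
        using p by (intro powr_mono2) (auto intro: norm_triangle_ineq)
      also have "\<dots> \<le> s * norm (f x) powr p + t * norm (g x) powr p"
        unfolding s_def t_def using p pos by (intro powr_add_le_weighted) auto
      finally show "ennreal (norm (f x + g x) powr p)
          \<le> ennreal s * ennreal (norm (f x) powr p) + ennreal t * ennreal (norm (g x) powr p)"
        using st by (simp add: ennreal_mult[symmetric] ennreal_plus[symmetric] ennreal_leI del: ennreal_plus)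
    qed
    also have "\<dots> = ennreal s * ennreal (Lp_norm M p f powr p) + ennreal t * ennreal (Lp_norm M p g powr p)"
      using p by (simp add: nn_integral_add nn_integral_cmult nn_integral_Lp[OF f] nn_integral_Lp[OF g])
    also have "\<dots> = ennreal (s * Lp_norm M p f powr p + t * Lp_norm M p g powr p)"
      using st by (simp add: ennreal_mult[symmetric] ennreal_plus[symmetric] del: ennreal_plus)
    also have "\<dots> \<le> ennreal (s * a powr p + t * b powr p)"
      using st a b p by (intro ennreal_leI add_mono mult_left_mono powr_mono2) auto
    also have "s * a powr p + t * b powr p = (a + b) powr (p - 1) * (a + b)"
      using pos by (simp add: s_def t_def field_simps)
    also have "\<dots> = (a + b) powr p"
      using pos by (simp add: powr_mult_base mult.commute)
    finally show ?thesis .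
  qed
  show "(\<lambda>x. f x + g x) \<in> Lp M p"
    using *[of "Lp_norm M p f + 1" "Lp_norm M p g + 1"] p
    by (intro Lp_I[where c = "Lp_norm M p f + 1 + (Lp_norm M p g + 1)"]) auto
  show "Lp_norm M p (\<lambda>x. f x + g x) \<le> Lp_norm M p f + Lp_norm M p g"
  proof (rule field_le_epsilon)
    fix e :: real
    assume "0 < e"
    then show "Lp_norm M p (\<lambda>x. f x + g x) \<le> Lp_norm M p f + Lp_norm M p g + e"
      using *[of "Lp_norm M p f + e / 2" "Lp_norm M p g + e / 2"] p
      by (intro Lp_norm_leI) (auto simp: algebra_simps)
  qed
qed

lemma Lp_scaleR: "f \<in> Lp M p \<Longrightarrow> (\<lambda>x. c *\<^sub>R f x) \<in> Lp M p"
  by (auto simp: Lp_def powr_mult)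

lemma Lp_norm_scaleR:
  assumes "0 < p"
  shows "Lp_norm M p (\<lambda>x. c *\<^sub>R f x) = \<bar>c\<bar> * Lp_norm M p f"
  using assms by (simp add: Lp_norm_def powr_mult powr_powr)

lemma Lp_diff:
  assumes "1 \<le> p" "f \<in> Lp M p" "g \<in> Lp M p"
  shows "(\<lambda>x. f x - g x) \<in> Lp M p"
  using Lp_add[OF assms(1,2) Lp_scaleR[OF assms(3), of "-1"]] by simp

lemma Lp_norm_minus_commute: "Lp_norm M p (\<lambda>x. f x - g x) = Lp_norm M p (\<lambda>x. g x - f x)"
  by (simp add: Lp_norm_def norm_minus_commute)

lemma Lp_norm_diff_triangle:
  assumes "1 \<le> p" "f \<in> Lp M p" "g \<in> Lp M p" "h \<in> Lp M p"
  shows "Lp_norm M p (\<lambda>x. f x - h x) \<le> Lp_norm M p (\<lambda>x. f x - g x) + Lp_norm M p (\<lambda>x. g x - h x)"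
  using Lp_norm_triangle[OF assms(1) Lp_diff[OF assms(1,2,3)] Lp_diff[OF assms(1,3,4)]] by simp

lemma Lp_norm_cong_AE:
  assumes "f \<in> borel_measurable M" "g \<in> borel_measurable M" "AE x in M. f x = g x"
  shows "Lp_norm M p f = Lp_norm M p g"
proof -
  have "(LINT x|M. norm (f x) powr p) = (LINT x|M. norm (g x) powr p)"
    using assms by (intro integral_cong_AE) auto
  then show ?thesis
    by (simp add: Lp_norm_def)
qed

lemma Lp_norm_eq_0_iff:
  assumes "f \<in> Lp M p" "0 < p"
  shows "Lp_norm M p f = 0 \<longleftrightarrow> (AE x in M. f x = 0)"
proof -
  have "Lp_norm M p f = 0 \<longleftrightarrow> (LINT x|M. norm (f x) powr p) = 0"
    by (simp add: Lp_norm_def)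
  also have "\<dots> \<longleftrightarrow> (AE x in M. norm (f x) powr p = 0)"
    using assms by (intro integral_nonneg_eq_0_iff_AE) (auto simp: Lp_def)
  finally show ?thesis
    by simp
qed

section \<open>Completeness of L^p\<close>

text \<open>Riesz-Fischer: a rapidly Cauchy subsequence converges almost everywhere, and Fatou's
  lemma along it carries the Cauchy estimates of the full sequence over to the pointwise
  limit.\<close>

lemma Lp_complete:
  fixes s :: "nat \<Rightarrow> 'a \<Rightarrow> 'b::euclidean_space"
  assumes p: "1 \<le> p" and s: "\<And>n. s n \<in> Lp M p"
    and Cauchy: "\<And>e. 0 < e \<Longrightarrow> \<exists>N. \<forall>m\<ge>N. \<forall>n\<ge>N. Lp_norm M p (\<lambda>x. s m x - s n x) < e"
  obtains f where "f \<in> Lp M p" "(\<lambda>n. Lp_norm M p (\<lambda>x. s n x - f x)) \<longlonglongrightarrow> 0"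
proof -
  have sm [measurable]: "s n \<in> borel_measurable M" for n
    using s by (simp add: Lp_def)
  \<comment> \<open>Consecutive terms of the subsequence \<open>s \<circ> r\<close> are within \<open>4\<^sup>-\<^sup>k\<close> in norm, so the integrals of
    \<open>e k\<close> are summable and the differences are eventually below \<open>2\<^sup>-\<^sup>k\<close> almost everywhere.\<close>
  define \<eta> :: "nat \<Rightarrow> real" where "\<eta> k = (1 / 2) ^ k * (1 / 2) ^ k" for k
  have "\<exists>N. \<forall>m\<ge>N. \<forall>n\<ge>N. Lp_norm M p (\<lambda>x. s m x - s n x) < \<eta> k" for k
    by (intro Cauchy) (simp add: \<eta>_def)
  then obtain N where N: "\<And>k m n. N k \<le> m \<Longrightarrow> N k \<le> n \<Longrightarrow> Lp_norm M p (\<lambda>x. s m x - s n x) < \<eta> k"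
    by metis
  \<comment> \<open>The sum makes both \<open>r k\<close> and \<open>r (Suc k)\<close> at least
    \<open>N k\<close>; the summand \<open>k\<close> makes \<open>r\<close> tend to
    infinity.\<close>
  define r where "r k = (\<Sum>i\<le>k. N i) + k" for k
  have rN: "N k \<le> r k" for k
    unfolding r_def by (rule trans_le_add1) (rule member_le_sum; simp)
  have rS: "N k \<le> r (Suc k)" for k
    unfolding r_def by (rule trans_le_add1) (rule member_le_sum; simp)
  define d where "d k x = norm (s (r (Suc k)) x - s (r k) x)" for k x
  define e where "e k x = ennreal (((2 ^ k) * d k x) powr p)" for k x
  have [measurable]: "e k \<in> borel_measurable M" for k
    unfolding e_def d_def by measurable
  have e_int: "(\<integral>\<^sup>+x. e k x \<partial>M) \<le> ennreal ((1 / 2) ^ k)" for k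
  proof -
    let ?g = "\<lambda>x. (2 ^ k) *\<^sub>R (s (r (Suc k)) x - s (r k) x)"
    have g: "?g \<in> Lp M p"
      by (intro Lp_scaleR Lp_diff p s)
    have "Lp_norm M p ?g = 2 ^ k * Lp_norm M p (\<lambda>x. s (r (Suc k)) x - s (r k) x)"
      using p by (subst Lp_norm_scaleR) auto
    also have "\<dots> \<le> 2 ^ k * \<eta> k"
      using N[OF rS rN, of k] by (intro mult_left_mono) auto
    also have "\<dots> = (1 / 2) ^ k"
      by (simp add: \<eta>_def field_simps)
    finally have le: "Lp_norm M p ?g \<le> (1 / 2) ^ k" .
    have "(\<integral>\<^sup>+x. e k x \<partial>M) = (\<integral>\<^sup>+x. ennreal (norm (?g x) powr p) \<partial>M)"
      by (simp add: e_def d_def)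
    also have "\<dots> = ennreal (Lp_norm M p ?g powr p)"
      using p by (intro nn_integral_Lp g) auto
    also have "\<dots> \<le> ennreal ((1 / 2) ^ k)"
    proof (rule ennreal_leI)
      have "Lp_norm M p ?g powr p \<le> Lp_norm M p ?g powr 1"
        using p le power_le_one[of "1 / 2 :: real" k] by (intro powr_mono') auto
      then show "Lp_norm M p ?g powr p \<le> (1 / 2) ^ k"
        using le by simp
    qed
    finally show ?thesis .
  qed
  have "(\<integral>\<^sup>+x. (\<Sum>k. e k x) \<partial>M) = (\<Sum>k. \<integral>\<^sup>+x. e k x \<partial>M)"
    by (rule nn_integral_suminf) simp
  also have "\<dots> \<le> (\<Sum>k. ennreal ((1 / 2) ^ k))"
    by (intro suminf_le e_int) auto
  also have "\<dots> = ennreal (\<Sum>k. (1 / 2) ^ k)"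
    by (intro suminf_ennreal_eq) (auto intro!: summable_sums summable_geometric)
  also have "\<dots> < \<infinity>"
    by simp
  finally have "AE x in M. (\<Sum>k. e k x) \<noteq> \<infinity>"
    by (intro nn_integral_PInf_AE) auto
  then have conv: "AE x in M. convergent (\<lambda>k. s (r k) x)"
  proof eventually_elim
    case (elim x)
    have "summable (\<lambda>k. (2 ^ k * d k x) powr p)"
      using elim unfolding e_def by (intro summable_suminf_not_top) (auto simp: top_ennreal_def)
    then have "(\<lambda>k. (2 ^ k * d k x) powr p) \<longlonglongrightarrow> 0"
      by (rule summable_LIMSEQ_zero)
    then have "\<forall>\<^sub>F k in sequentially. (2 ^ k * d k x) powr p < 1"
      by (rule order_tendstoD) simp
    then have "\<forall>\<^sub>F k in sequentially. norm (s (r (Suc k)) x - s (r k) x) \<le> (1 / 2) ^ k"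
    proof eventually_elim
      case (elim k)
      then have "2 ^ k * d k x < 1"
        using p by (smt (verit, best) ge_one_powr_ge_zero)
      then show ?case
        by (simp add: d_def field_simps power_one_over)
    qed
    then have "summable (\<lambda>k. s (r (Suc k)) x - s (r k) x)"
      by (rule summable_comparison_test_ev) (simp add: summable_geometric)
    then have "convergent (\<lambda>n. \<Sum>k<n. s (r (Suc k)) x - s (r k) x)"
      by (simp add: summable_iff_convergent)
    then have "convergent (\<lambda>n. s (r n) x - s (r 0) x)"
      by (simp add: sum_lessThan_telescope[of "\<lambda>k. s (r k) x"])
    then have "convergent (\<lambda>n. (s (r n) x - s (r 0) x) + s (r 0) x)"
      by (intro convergent_add convergent_const)
    then show ?case
      by simp
  qed
  \<comment> \<open>Where the subsequence diverges, which happens on a null set only,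
    \<open>lim\<close> has an unspecified value; \<open>f\<close> is measurable all the
    same.\<close>
  define f where "f x = lim (\<lambda>k. s (r k) x)" for x
  have [measurable]: "f \<in> borel_measurable M"
    unfolding f_def by measurable
  have lim: "AE x in M. (\<lambda>k. s (r k) x) \<longlonglongrightarrow> f x"
    using conv by eventually_elim (simp add: f_def convergent_LIMSEQ_iff)
  have rk: "k \<le> r k" for k
    by (simp add: r_def)
  have *: "(\<integral>\<^sup>+x. ennreal (norm (s n x - f x) powr p) \<partial>M) \<le> ennreal (c powr p)"
    if c: "\<And>m. m \<ge> n0 \<Longrightarrow> Lp_norm M p (\<lambda>x. s n x - s m x) < c" for n n0 c
  proof -
    have "(\<integral>\<^sup>+x. ennreal (norm (s n x - f x) powr p) \<partial>M)
        = (\<integral>\<^sup>+x. liminf (\<lambda>k. ennreal (norm (s n x - s (r k) x) powr p)) \<partial>M)"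
    proof (rule nn_integral_cong_AE)
      show "AE x in M. ennreal (norm (s n x - f x) powr p)
          = liminf (\<lambda>k. ennreal (norm (s n x - s (r k) x) powr p))"
        using lim
      proof eventually_elim
        case (elim x)
        have "(\<lambda>k. norm (s n x - s (r k) x) powr p) \<longlonglongrightarrow> norm (s n x - f x) powr p"
          using p by (intro tendsto_powr' tendsto_norm tendsto_diff tendsto_const elim) auto
        then have "(\<lambda>k. ennreal (norm (s n x - s (r k) x) powr p)) \<longlonglongrightarrow> ennreal (norm (s n x - f x) powr p)"
          by (rule tendsto_ennrealI)
        then show ?case
          by (intro lim_imp_Liminf[symmetric]) auto
      qed
    qed
    also have "\<dots> \<le> liminf (\<lambda>k. \<integral>\<^sup>+x. ennreal (norm (s n x - s (r k) x) powr p) \<partial>M)"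
      by (rule nn_integral_liminf) simp
    also have "\<dots> \<le> liminf (\<lambda>k::nat. ennreal (c powr p))"
    proof (rule Liminf_mono)
      show "\<forall>\<^sub>F k in sequentially. (\<integral>\<^sup>+x. ennreal (norm (s n x - s (r k) x) powr p) \<partial>M) \<le> ennreal (c powr p)"
        using eventually_ge_at_top[of n0]
      proof eventually_elim
        case (elim k)
        then have "Lp_norm M p (\<lambda>x. s n x - s (r k) x) < c"
          using rk[of k] by (intro c) linarith
        then show ?case
          using p by (subst nn_integral_Lp) (auto intro!: Lp_diff s ennreal_leI powr_mono2)
      qed
    qed
    also have "\<dots> = ennreal (c powr p)"
      by (simp add: Liminf_const)
    finally show ?thesis .
  qed
  have ex: "\<exists>N. \<forall>n\<ge>N. (\<integral>\<^sup>+x. ennreal (norm (s n x - f x) powr p) \<partial>M) \<le> ennreal (c powr p)" if "0 < c" for c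
    using Cauchy[OF that] * by meson
  obtain n1 where n1: "(\<integral>\<^sup>+x. ennreal (norm (s n1 x - f x) powr p) \<partial>M) \<le> ennreal (1 powr p)"
    using ex[of 1] by auto
  have "(\<lambda>x. s n1 x - f x) \<in> Lp M p"
    using p n1 by (intro Lp_I[where c = 1]) auto
  from Lp_diff[OF p s[of n1] this] have f: "f \<in> Lp M p"
    by simp
  have "(\<lambda>n. Lp_norm M p (\<lambda>x. s n x - f x)) \<longlonglongrightarrow> 0"
  proof (rule LIMSEQ_I)
    fix c :: real
    assume c: "0 < c"
    with ex[of "c / 2"] obtain N where N: "\<And>n. n \<ge> N \<Longrightarrow>
        (\<integral>\<^sup>+x. ennreal (norm (s n x - f x) powr p) \<partial>M) \<le> ennreal ((c / 2) powr p)"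
      by auto
    have "Lp_norm M p (\<lambda>x. s n x - f x) \<le> c / 2" if "n \<ge> N" for n
      using p c N[OF that] by (intro Lp_norm_leI) auto
    then show "\<exists>N. \<forall>n\<ge>N. norm (Lp_norm M p (\<lambda>x. s n x - f x) - 0) < c"
      using c by (intro exI[of _ N]) force
  qed
  with f show ?thesis
    by (rule that)
qed

section \<open>The metric space of classes\<close>

lemma Lp_class_eq_iff:
  assumes "f \<in> Lp M p" "g \<in> Lp M p"
  shows "Lp_class M p f = Lp_class M p g \<longleftrightarrow> (AE x in M. f x = g x)"
proof
  assume "Lp_class M p f = Lp_class M p g"
  moreover have "f \<in> Lp_class M p f"
    using assms by (simp add: Lp_class_def)
  ultimately show "AE x in M. f x = g x"
    by (simp add: Lp_class_def)
next
  assume fg: "AE x in M. f x = g x"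
  have "(AE x in M. h x = f x) \<longleftrightarrow> (AE x in M. h x = g x)" for h
    using fg by (auto elim: eventually_elim2)
  then show "Lp_class M p f = Lp_class M p g"
    by (simp add: Lp_class_def)
qed

lemma Lp_class_in_Lp_space: "f \<in> Lp M p \<Longrightarrow> Lp_class M p f \<in> Lp_space M p"
  by (simp add: Lp_space_def)

text \<open>The distance is computed from representatives picked by \<open>SOME\<close>. These agree
  almost everywhere with the given functions, and the norm does not see the difference.\<close>

lemma Lp_dist_class:
  fixes f g :: "'a \<Rightarrow> 'b::euclidean_space"
  assumes "f \<in> Lp M p" "g \<in> Lp M p"
  shows "Lp_dist M p (Lp_class M p f) (Lp_class M p g) = Lp_norm M p (\<lambda>x. f x - g x)"
proof -
  define rep where "rep u = (SOME h. h \<in> Lp_class M p u)" for u :: "'a \<Rightarrow> 'b"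
  have "rep u \<in> Lp_class M p u" if "u \<in> Lp M p" for u :: "'a \<Rightarrow> 'b"
    unfolding rep_def by (rule someI[of _ u]) (simp add: Lp_class_def that)
  then have rep: "rep u \<in> borel_measurable M \<and> (AE x in M. rep u x = u x)"
    if "u \<in> Lp M p" for u :: "'a \<Rightarrow> 'b"
    using that by (simp add: Lp_class_def Lp_def)
  show ?thesis
    unfolding Lp_dist_def rep_def[symmetric]
  proof (rule Lp_norm_cong_AE)
    from rep[OF assms(1)] rep[OF assms(2)]
    have "AE x in M. rep f x = f x" "AE x in M. rep g x = g x"
      by simp_all
    then show "AE x in M. rep f x - rep g x = f x - g x"
      by eventually_elim simp
    show "(\<lambda>x. rep f x - rep g x) \<in> borel_measurable M"
      using rep[OF assms(1)] rep[OF assms(2)] by (intro borel_measurable_diff) auto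
    show "(\<lambda>x. f x - g x) \<in> borel_measurable M"
      using assms by (intro borel_measurable_diff Lp_measurable)
  qed
qed

lemma Metric_space_Lp:
  assumes p: "1 \<le> p"
  shows "Metric_space (Lp_space M p :: ('a \<Rightarrow> 'b::euclidean_space) set set) (Lp_dist M p)"
proof
  fix X Y Z :: "('a \<Rightarrow> 'b) set"
  show "0 \<le> Lp_dist M p X Y"
    by (simp add: Lp_dist_def)
  show "Lp_dist M p X Y = Lp_dist M p Y X"
    unfolding Lp_dist_def by (rule Lp_norm_minus_commute)
  assume "X \<in> Lp_space M p" "Y \<in> Lp_space M p"
  then obtain f g where fg: "f \<in> Lp M p" "X = Lp_class M p f" "g \<in> Lp M p" "Y = Lp_class M p g"
    by (auto simp: Lp_space_def)
  then show "Lp_dist M p X Y = 0 \<longleftrightarrow> X = Y"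
    using p by (simp add: Lp_dist_class Lp_norm_eq_0_iff Lp_diff Lp_class_eq_iff)
  assume "Z \<in> Lp_space M p"
  then obtain h where "h \<in> Lp M p" "Z = Lp_class M p h"
    by (auto simp: Lp_space_def)
  then show "Lp_dist M p X Z \<le> Lp_dist M p X Y + Lp_dist M p Y Z"
    using fg p by (simp add: Lp_dist_class Lp_norm_diff_triangle)
qed

lemma mcomplete_Lp:
  assumes p: "1 \<le> p"
  shows "Metric_space.mcomplete (Lp_space M p :: ('a \<Rightarrow> 'b::euclidean_space) set set) (Lp_dist M p)"
proof -
  interpret Metric_space "Lp_space M p :: ('a \<Rightarrow> 'b) set set" "Lp_dist M p"
    by (rule Metric_space_Lp[OF p])
  show ?thesis
    unfolding mcomplete_def
  proof (intro allI impI)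
    fix \<sigma> :: "nat \<Rightarrow> ('a \<Rightarrow> 'b) set"
    assume \<sigma>: "MCauchy \<sigma>"
    then have "\<sigma> n \<in> Lp_space M p" for n
      by (auto simp: MCauchy_def)
    then have "\<forall>n. \<exists>f. f \<in> Lp M p \<and> \<sigma> n = Lp_class M p f"
      unfolding Lp_space_def by blast
    then obtain s where s: "\<And>n. s n \<in> Lp M p" "\<And>n. \<sigma> n = Lp_class M p (s n)"
      by metis
    have Cauchy: "\<exists>N. \<forall>m\<ge>N. \<forall>n\<ge>N. Lp_norm M p (\<lambda>x. s m x - s n x) < e" if "0 < e" for e
    proof -
      have "\<exists>N. \<forall>m n. N \<le> m \<longrightarrow> N \<le> n \<longrightarrow> Lp_dist M p (\<sigma> m) (\<sigma> n) < e"
        using \<sigma> that unfolding MCauchy_def by (elim conjE allE impE)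
      then show ?thesis
        unfolding s(2) Lp_dist_class[OF s(1) s(1)] by auto
    qed
    obtain f where f: "f \<in> Lp M p" "(\<lambda>n. Lp_norm M p (\<lambda>x. s n x - f x)) \<longlonglongrightarrow> 0"
      by (rule Lp_complete[OF p s(1) Cauchy])
    then have "limitin mtopology \<sigma> (Lp_class M p f) sequentially"
      unfolding limitin_metric_dist_null s(2) using s(1) f(1) by (simp add: Lp_dist_class Lp_class_in_Lp_space)
    then show "\<exists>x. limitin mtopology \<sigma> x sequentially" ..
  qed
qed

section \<open>Precompactness by finite nets\<close>

text \<open>Hausdorff's criterion: total boundedness passes to the closure and yields Cauchy
  subsequences, completeness makes them converge, and the closure contains their limits.\<close>

lemma (in Metric_space) compactin_closure_of_iff_mtotally_bounded:
  assumes "mcomplete" "S \<subseteq> M"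
  shows "compactin mtopology (mtopology closure_of S) \<longleftrightarrow> mtotally_bounded S"
proof
  assume "compactin mtopology (mtopology closure_of S)"
  then show "mtotally_bounded S"
    using assms(2) compactin_imp_mtotally_bounded mtotally_bounded_closure_of_eq by blast
next
  assume "mtotally_bounded S"
  then have tb: "mtotally_bounded (mtopology closure_of S)"
    by (rule mtotally_bounded_closure_of)
  show "compactin mtopology (mtopology closure_of S)"
    unfolding compactin_sequentially
  proof (intro conjI allI impI)
    show "mtopology closure_of S \<subseteq> M"
      using closure_of_subset_topspace topspace_mtopology by metis
    fix \<sigma> :: "nat \<Rightarrow> 'a"
    assume \<sigma>: "range \<sigma> \<subseteq> mtopology closure_of S"
    then obtain r where r: "strict_mono r" "MCauchy (\<sigma> \<circ> r)"
      using tb unfolding mtotally_bounded_sequentially by meson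
    then obtain l where l: "limitin mtopology (\<sigma> \<circ> r) l sequentially"
      using assms(1) by (auto simp: mcomplete_def)
    have "l \<in> mtopology closure_of S"
      by (rule limitin_closedin[OF l]) (use \<sigma> in \<open>auto intro!: always_eventually\<close>)
    with l r show "\<exists>l r. l \<in> mtopology closure_of S \<and> strict_mono r \<and> limitin mtopology (\<sigma> \<circ> r) l sequentially"
      by blast
  qed
qed

text \<open>Descends from classes to functions, on which translations and averages act. The centres
  of the nets lie in \<open>K\<close> itself, so estimates uniform on \<open>K\<close> hold for them
  too.\<close>

lemma Lp_precompact_iff:
  fixes K :: "('a \<Rightarrow> 'b::euclidean_space) set"
  assumes p: "1 \<le> p" and K: "K \<subseteq> Lp M p"
  shows "Lp_precompact M p K \<longleftrightarrow>
    (\<forall>e>0. \<exists>F\<subseteq>K. finite F \<and> (\<forall>f\<in>K. \<exists>g\<in>F. Lp_norm M p (\<lambda>x. f x - g x) < e))"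
proof -
  interpret Metric_space "Lp_space M p :: ('a \<Rightarrow> 'b) set set" "Lp_dist M p"
    by (rule Metric_space_Lp[OF p])
  let ?c = "Lp_class M p"
  have sub: "?c ` K \<subseteq> Lp_space M p"
    using K by (auto simp: Lp_space_def)
  have ball: "?c f \<in> mball (?c g) e \<longleftrightarrow> Lp_norm M p (\<lambda>x. f x - g x) < e"
    if "f \<in> K" "g \<in> K" for f g e
  proof -
    have "f \<in> Lp M p" "g \<in> Lp M p" "?c f \<in> Lp_space M p" "?c g \<in> Lp_space M p"
      using that K sub by auto
    then show ?thesis
      by (simp add: Lp_dist_class Lp_norm_minus_commute[of M p g f])
  qed
  have "Lp_precompact M p K \<longleftrightarrow> mtotally_bounded (?c ` K)"
    unfolding Lp_precompact_def Lp_topology_def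
    by (rule compactin_closure_of_iff_mtotally_bounded[OF mcomplete_Lp[OF p] sub])
  also have "\<dots> \<longleftrightarrow> (\<forall>e>0. \<exists>F. finite F \<and> F \<subseteq> K \<and> (\<forall>f\<in>K. \<exists>g\<in>F. ?c f \<in> mball (?c g) e))"
    unfolding mtotally_bounded_def ex_finite_subset_image by (simp add: image_subset_iff del: in_mball)
  also have "\<dots> \<longleftrightarrow> (\<forall>e>0. \<exists>F\<subseteq>K. finite F \<and> (\<forall>f\<in>K. \<exists>g\<in>F. Lp_norm M p (\<lambda>x. f x - g x) < e))"
  proof -
    have "(\<forall>f\<in>K. \<exists>g\<in>F. ?c f \<in> mball (?c g) e) \<longleftrightarrow>
        (\<forall>f\<in>K. \<exists>g\<in>F. Lp_norm M p (\<lambda>x. f x - g x) < e)" if "F \<subseteq> K" for F e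
      using that by (intro ball_cong bex_cong refl ball) auto
    then show ?thesis
      by (simp add: conj_ac del: in_mball cong: conj_cong)
  qed
  finally show ?thesis .
qed

section \<open>Comparison estimates and Jensen's inequality\<close>

lemma
  assumes p: "0 < p" and f: "f \<in> Lp M p" and g: "g \<in> borel_measurable M"
    and le: "\<And>x. x \<in> space M \<Longrightarrow> norm (g x) \<le> norm (f x)"
  shows Lp_mono: "g \<in> Lp M p" and Lp_norm_mono: "Lp_norm M p g \<le> Lp_norm M p f"
proof -
  have "(\<integral>\<^sup>+x. ennreal (norm (g x) powr p) \<partial>M) \<le> (\<integral>\<^sup>+x. ennreal (norm (f x) powr p) \<partial>M)"
    using p le by (intro nn_integral_mono ennreal_leI powr_mono2) auto
  also have "\<dots> = ennreal (Lp_norm M p f powr p)"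
    by (rule nn_integral_Lp[OF f p])
  finally have *: "(\<integral>\<^sup>+x. ennreal (norm (g x) powr p) \<partial>M) \<le> ennreal (Lp_norm M p f powr p)" .
  show "g \<in> Lp M p"
    by (rule Lp_I[OF g p Lp_norm_nonneg *])
  show "Lp_norm M p g \<le> Lp_norm M p f"
    by (rule Lp_norm_leI[OF g p Lp_norm_nonneg *])
qed

text \<open>The passage from uniform to L^p estimates: averages vanish outside a ball, and
  \<open>\<mu>\<close> is finite on it.\<close>

lemma
  assumes p: "0 < p" and g: "g \<in> borel_measurable M" and S: "S \<in> sets M" "emeasure M S < \<infinity>" and c: "0 \<le> c"
    and le: "\<And>x. x \<in> S \<Longrightarrow> norm (g x) \<le> c" and zero: "\<And>x. x \<in> space M - S \<Longrightarrow> g x = 0"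
  shows Lp_bounded_support: "g \<in> Lp M p"
    and Lp_norm_bounded_support: "Lp_norm M p g \<le> c * measure M S powr (1 / p)"
proof -
  have "(\<integral>\<^sup>+x. ennreal (norm (g x) powr p) \<partial>M) \<le> (\<integral>\<^sup>+x. ennreal (c powr p) * indicator S x \<partial>M)"
    using p le zero by (intro nn_integral_mono) (auto simp: indicator_def intro!: ennreal_leI powr_mono2)
  also have "\<dots> = ennreal (c powr p) * ennreal (measure M S)"
    using S by (simp add: nn_integral_cmult_indicator emeasure_eq_ennreal_measure)
  also have "\<dots> = ennreal ((c * measure M S powr (1 / p)) powr p)"
    using p c by (simp add: ennreal_mult[symmetric] powr_mult powr_powr)
  finally have *: "(\<integral>\<^sup>+x. ennreal (norm (g x) powr p) \<partial>M)
      \<le> ennreal ((c * measure M S powr (1 / p)) powr p)" .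
  have c': "0 \<le> c * measure M S powr (1 / p)"
    using c by simp
  show "g \<in> Lp M p"
    by (rule Lp_I[OF g p c' *])
  show "Lp_norm M p g \<le> c * measure M S powr (1 / p)"
    by (rule Lp_norm_leI[OF g p c' *])
qed

text \<open>Integrate the tangent inequality at the mean \<open>m\<close> of the norms over
  \<open>S\<close>; the linear terms cancel. The right-hand side is extended-valued, ready for
  Tonelli, and the estimate is trivial if the p-th power is not integrable.\<close>

lemma Jensen_norm_powr:
  fixes g :: "'a \<Rightarrow> 'b::euclidean_space"
  assumes p: "1 \<le> p" and S: "S \<in> sets M" "0 < measure M S"
    and g: "integrable M g" and zero: "\<And>t. t \<notin> S \<Longrightarrow> g t = 0"
  shows "ennreal (norm ((1 / measure M S) *\<^sub>R (LINT t|M. g t)) powr p)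
    \<le> ennreal (1 / measure M S) * (\<integral>\<^sup>+t. ennreal (norm (g t) powr p) \<partial>M)"
proof (cases "integrable M (\<lambda>t. norm (g t) powr p)")
  case False
  have "(\<lambda>t. norm (g t) powr p) \<in> borel_measurable M"
    using g by simp
  with False have "(\<integral>\<^sup>+t. ennreal (norm (g t) powr p) \<partial>M) = \<infinity>"
    by (auto simp: integrable_iff_bounded not_less top_unique)
  then show ?thesis
    using S by (simp add: ennreal_mult_top)
next
  case int: True
  define A where "A = measure M S"
  have A: "0 < A" using S by (simp add: A_def)
  \<comment> \<open>\<open>measure\<close> is 0 by convention on sets of infinite measure, so its
    positivity forces finiteness.\<close>
  have S_fin: "emeasure M S < \<infinity>"
  proof (rule ccontr)
    assume "\<not> emeasure M S < \<infinity>"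
    then show False
      using S(2) by (simp add: measure_def less_top[symmetric])
  qed
  define m where "m = (1 / A) * (LINT t|M. norm (g t))"
  have m: "norm ((1 / A) *\<^sub>R (LINT t|M. g t)) \<le> m"
    using A by (simp add: m_def divide_right_mono integral_norm_bound)
  have "A * m powr p \<le> (LINT t|M. norm (g t) powr p)"
  proof (cases "m = 0")
    case True
    then show ?thesis by simp
  next
    case False
    then have m0: "0 < m"
      using m by (smt (verit) norm_ge_zero)
    \<comment> \<open>The indicator keeps the constant part of the tangent integrable, since
      \<open>M\<close> itself may be infinite. Off \<open>S\<close> both sides vanish because
      \<open>g\<close> does.\<close>
    have "(LINT t|M. indicator S t * (m powr p - p * m powr (p - 1) * m) + p * m powr (p - 1) * norm (g t))
        \<le> (LINT t|M. norm (g t) powr p)"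
    proof (rule integral_mono)
      show "indicator S t * (m powr p - p * m powr (p - 1) * m) + p * m powr (p - 1) * norm (g t)
          \<le> norm (g t) powr p" for t
        using powr_above_tangent[OF p _ m0, of "norm (g t)"] zero[of t]
        by (cases "t \<in> S") (auto simp: algebra_simps)
    qed (use g S S_fin int in auto)
    also have "(LINT t|M. indicator S t * (m powr p - p * m powr (p - 1) * m) + p * m powr (p - 1) * norm (g t))
        = A * (m powr p - p * m powr (p - 1) * m) + p * m powr (p - 1) * (LINT t|M. norm (g t))"
      using g S S_fin sets.sets_into_space[OF S(1)] by (subst Bochner_Integration.integral_add) (auto simp: A_def Int_absorb2)
    also have "\<dots> = A * m powr p"
      using A by (simp add: m_def algebra_simps)
    finally show ?thesis .
  qed
  then have "m powr p \<le> (1 / A) * (LINT t|M. norm (g t) powr p)"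
    using A by (simp add: field_simps)
  moreover have "norm ((1 / A) *\<^sub>R (LINT t|M. g t)) powr p \<le> m powr p"
    using p m by (intro powr_mono2) auto
  ultimately have "ennreal (norm ((1 / A) *\<^sub>R (LINT t|M. g t)) powr p)
      \<le> ennreal ((1 / A) * (LINT t|M. norm (g t) powr p))"
    by (intro ennreal_leI) linarith
  also have "\<dots> = ennreal (1 / A) * (\<integral>\<^sup>+t. ennreal (norm (g t) powr p) \<partial>M)"
    using A int by (subst ennreal_mult) (auto simp: nn_integral_eq_integral)
  finally show ?thesis
    by (simp add: A_def)
qed

section \<open>Finite nets\<close>

text \<open>The balls around points of \<open>S\<close> already cover the closure, which is compact;
  so the centres can be taken in \<open>S\<close>.\<close>

lemma bounded_finite_net:
  fixes S :: "'a::euclidean_space set"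
  assumes "bounded S" "0 < e"
  obtains X where "finite X" "X \<subseteq> S" "S \<subseteq> (\<Union>x\<in>X. ball x e)"
proof -
  have "closure S \<subseteq> (\<Union>x\<in>S. ball x e)"
    using assms(2) by (auto simp: closure_approachable)
  then obtain X where "X \<subseteq> S" "finite X" "closure S \<subseteq> (\<Union>x\<in>X. ball x e)"
    using assms(1) by (metis compactE_image compact_closure open_ball)
  then show ?thesis
    using closure_subset[of S] that by blast
qed

text \<open>Round every value on \<open>X\<close> to a point of a finite net of the ball of radius
  \<open>C\<close>. Only finitely many rounding patterns occur, and one member of \<open>K\<close>
  for each pattern suffices.\<close>

lemma pointwise_bounded_finite_net:
  fixes F :: "'i \<Rightarrow> 'x \<Rightarrow> 'b::euclidean_space"
  assumes X: "finite X" and bound: "\<And>f x. f \<in> K \<Longrightarrow> x \<in> X \<Longrightarrow> norm (F f x) \<le> C" and e: "0 < e"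
  obtains G where "finite G" "G \<subseteq> K" "\<forall>f\<in>K. \<exists>g\<in>G. \<forall>x\<in>X. norm (F f x - F g x) < e"
proof -
  have e2: "0 < e / 2"
    using e by simp
  obtain Y where Y: "finite Y" "cball (0 :: 'b) C \<subseteq> (\<Union>y\<in>Y. ball y (e / 2))"
    by (rule bounded_finite_net[OF bounded_cball e2])
  have "\<exists>y\<in>Y. dist y (F f x) < e / 2" if "f \<in> K" "x \<in> X" for f x
  proof -
    have "F f x \<in> cball 0 C"
      using bound[OF that] by simp
    then have "F f x \<in> (\<Union>y\<in>Y. ball y (e / 2))"
      using Y(2) by (rule rev_subsetD)
    then show ?thesis
      by (simp only: UN_iff mem_ball)
  qed
  then obtain c where c: "\<And>f x. f \<in> K \<Longrightarrow> x \<in> X \<Longrightarrow> c f x \<in> Y \<and> dist (c f x) (F f x) < e / 2"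
    by metis
  \<comment> \<open>Restriction to \<open>X\<close> places the patterns in the finite set
    \<open>X \<rightarrow>\<^sub>E Y\<close>.\<close>
  define \<Phi> where "\<Phi> f = restrict (c f) X" for f
  have "\<Phi> ` K \<subseteq> X \<rightarrow>\<^sub>E Y"
    using c by (auto simp: \<Phi>_def)
  then have "finite (\<Phi> ` K)"
    using X Y(1) by (meson finite_PiE finite_subset)
  then obtain G where G: "G \<subseteq> K" "finite G" "\<Phi> ` K = \<Phi> ` G"
    by (meson finite_subset_image subset_refl)
  have "\<exists>g\<in>G. \<forall>x\<in>X. norm (F f x - F g x) < e" if f: "f \<in> K" for f
  proof -
    obtain g where g: "g \<in> G" "\<Phi> f = \<Phi> g"
      using G(3) f by blast
    have "norm (F f x - F g x) < e" if x: "x \<in> X" for x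
    proof -
      have "c f x = c g x"
        using fun_cong[OF g(2), of x] x by (simp add: \<Phi>_def)
      moreover have "dist (c f x) (F f x) < e / 2" "dist (c g x) (F g x) < e / 2"
        using c f g(1) G(1) x by auto
      ultimately have "dist (F f x) (F g x) < e"
        by (metis dist_triangle_half_r)
      then show ?thesis
        by (simp add: dist_norm)
    qed
    with g(1) show ?thesis by blast
  qed
  then show ?thesis
    by (intro that[OF G(2,1)] ballI)
qed

text \<open>Arzela-Ascoli in terms of nets, on a set that is bounded but perhaps not closed:
  equicontinuity moves every point to one of finitely many sample points, at a cost of e/3 for each
  of the two functions, and the last e/3 is spent at the sample point.\<close>

lemma equicontinuous_finite_net:
  fixes F :: "'i \<Rightarrow> 'a::euclidean_space \<Rightarrow> 'b::euclidean_space"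
  assumes S: "bounded S" and bound: "\<And>f x. f \<in> K \<Longrightarrow> x \<in> S \<Longrightarrow> norm (F f x) \<le> C" and e: "0 < e"
    and equi: "\<And>e. 0 < e \<Longrightarrow> \<exists>d>0. \<forall>f\<in>K. \<forall>x\<in>S. \<forall>y\<in>S. dist x y \<le> d \<longrightarrow> norm (F f x - F f y) < e"
  obtains G where "finite G" "G \<subseteq> K" "\<forall>f\<in>K. \<exists>g\<in>G. \<forall>x\<in>S. norm (F f x - F g x) < e"
proof -
  obtain d where d: "0 < d"
      "\<And>f x y. f \<in> K \<Longrightarrow> x \<in> S \<Longrightarrow> y \<in> S \<Longrightarrow> dist x y \<le> d \<Longrightarrow> norm (F f x - F f y) < e / 3"
    using equi[of "e / 3"] e by auto
  obtain X where X: "finite X" "X \<subseteq> S" "S \<subseteq> (\<Union>x\<in>X. ball x d)"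
    using bounded_finite_net[OF S d(1)] .
  have boundX: "norm (F f x) \<le> C" if "f \<in> K" "x \<in> X" for f x
    using bound that X(2) by auto
  have e3: "0 < e / 3"
    using e by simp
  obtain G where G: "finite G" "G \<subseteq> K" "\<forall>f\<in>K. \<exists>g\<in>G. \<forall>x\<in>X. norm (F f x - F g x) < e / 3"
    by (rule pointwise_bounded_finite_net[OF X(1) boundX e3])
  show ?thesis
  proof (rule that[OF G(1,2)], rule ballI)
    fix f assume f: "f \<in> K"
    then obtain g where g: "g \<in> G" "\<And>x. x \<in> X \<Longrightarrow> norm (F f x - F g x) < e / 3"
      using G(3) by blast
    have "norm (F f y - F g y) < e" if y: "y \<in> S" for y
    proof -
      obtain x where x: "x \<in> X" "dist x y < d"
        using X(3) y by auto
      have "norm (F f x - F f y) < e / 3" "norm (F g x - F g y) < e / 3"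
        using d(2)[of f x y] d(2)[of g x y] f g(1) G(2) x y X(2) by auto
      then show ?thesis
        using g(2)[OF x(1)] dist_triangle[of "F f y" "F g y" "F f x"] dist_triangle[of "F f x" "F g y" "F g x"]
        by (simp add: dist_norm norm_minus_commute)
    qed
    with g(1) show "\<exists>g\<in>G. \<forall>x\<in>S. norm (F f x - F g x) < e"
      by blast
  qed
qed

lemma finite_uniform_delta:
  fixes P :: "'i \<Rightarrow> real \<Rightarrow> bool"
  assumes "finite F" "\<And>g. g \<in> F \<Longrightarrow> \<exists>\<delta>>0. P g \<delta>"
    and anti: "\<And>g \<delta> \<delta>'. P g \<delta> \<Longrightarrow> \<delta>' \<le> \<delta> \<Longrightarrow> P g \<delta>'"
  shows "\<exists>\<delta>>0. \<forall>g\<in>F. P g \<delta>"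
  using assms(1,2)
proof (induction F)
  case empty
  then show ?case by (auto intro: exI[of _ 1])
next
  case (insert g F)
  then obtain \<delta> \<delta>' where "0 < \<delta>" "\<forall>g\<in>F. P g \<delta>" "0 < \<delta>'" "P g \<delta>'"
    by (metis insertCI)
  then have "0 < min \<delta> \<delta>' \<and> (\<forall>h\<in>insert g F. P h (min \<delta> \<delta>'))"
    using anti[of _ \<delta> "min \<delta> \<delta>'"] anti[of _ \<delta>' "min \<delta> \<delta>'"] by auto
  then show ?case by blast
qed

section \<open>Borel measures on a subset of a Euclidean space\<close>

text \<open>Carries measurability in the ambient space over to \<open>M\<close>, for sets such as
  balls and intervals.\<close>

lemma id_measurable_borel:
  assumes "sets M = sets (restrict_space borel X)"
  shows "(\<lambda>x. x) \<in> M \<rightarrow>\<^sub>M (borel :: 'a::euclidean_space measure)"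
proof -
  have "(\<lambda>x. x) \<in> restrict_space borel X \<rightarrow>\<^sub>M (borel :: 'a measure)"
    by (rule measurable_restrict_space1) simp
  then show ?thesis
    by (simp add: measurable_cong_sets[OF assms refl])
qed

lemma space_restrict_borel:
  assumes "sets M = sets (restrict_space borel X)"
  shows "space M = X"
  using sets_eq_imp_space_eq[OF assms] by (simp add: space_restrict_space)

text \<open>Balls of integer radius exhaust the space. Sigma-finiteness is what Tonelli's theorem
  and the measurability of averages in \<open>x\<close> rest on.\<close>

lemma sigma_finite_on_bounded:
  fixes M :: "'a::euclidean_space measure"
  assumes M: "sets M = sets (restrict_space borel X)" and fin: "finite_on_bounded M"
  shows "sigma_finite_measure M"
proof
  note [measurable] = id_measurable_borel[OF M]
  let ?A = "range (\<lambda>n::nat. {x \<in> space M. norm x < n})"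
  have "emeasure M {x \<in> space M. norm x < real n} \<noteq> \<infinity>" for n
  proof -
    have "bounded {x \<in> space M. norm x < real n}"
      by (rule bounded_subset[OF bounded_ball[of 0 "real n"]]) auto
    then show ?thesis
      using fin by (auto simp: finite_on_bounded_def less_top)
  qed
  moreover have "\<Union>?A = space M"
    using reals_Archimedean2 by auto
  ultimately show "\<exists>A. countable A \<and> A \<subseteq> sets M \<and> \<Union>A = space M \<and> (\<forall>a\<in>A. emeasure M a \<noteq> \<infinity>)"
    by (intro exI[of _ ?A]) auto
qed

section \<open>Translations\<close>

locale lp_translation =
  fixes I :: "'a::euclidean_space set" and J :: "real set"
    and \<mu> :: "'a measure" and \<nu> :: "real measure" and p :: real
    and T :: "real \<Rightarrow> ('a \<Rightarrow> 'b) \<Rightarrow> 'a \<Rightarrow> 'b::{real_normed_field,euclidean_space}"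
  assumes J0: "0 \<in> J"
    and p: "1 \<le> p"
    and \<mu>: "sets \<mu> = sets (restrict_space borel I)" "finite_on_bounded \<mu>"
    and \<nu>: "sets \<nu> = sets (restrict_space borel J)" "finite_on_bounded \<nu>"
    and \<nu>_pos: "\<And>a. 0 < a \<Longrightarrow> 0 < measure \<nu> ({-a<..<a} \<inter> J)"
    and T: "translation I J p \<mu> \<nu> T" "bounded_translation J p \<mu> T" "regular_translation I J p \<mu> \<nu> T"
begin

abbreviation "L \<equiv> Lp \<mu> p :: ('a \<Rightarrow> 'b) set"

abbreviation "nrm \<equiv> Lp_norm \<mu> p :: ('a \<Rightarrow> 'b) \<Rightarrow> real"

abbreviation "Av \<equiv> avg J \<nu> T"

lemma p_pos: "0 < p"
  using p by simp

lemmas diff_L = Lp_diff[OF p]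

lemma space_\<mu>: "space \<mu> = I" and space_\<nu>: "space \<nu> = J"
  by (rule space_restrict_borel \<mu> \<nu>)+

lemma id_measurable [measurable]: "(\<lambda>x. x) \<in> \<mu> \<rightarrow>\<^sub>M borel" "(\<lambda>t. t) \<in> \<nu> \<rightarrow>\<^sub>M borel"
  by (rule id_measurable_borel \<mu> \<nu>)+

sublocale \<mu>: sigma_finite_measure \<mu>
  by (rule sigma_finite_on_bounded \<mu>)+

sublocale \<nu>: sigma_finite_measure \<nu>
  by (rule sigma_finite_on_bounded \<nu>)+

sublocale pair_sigma_finite \<mu> \<nu>
  by standard

lemma ball_sets: "{x \<in> I. norm x < R} \<in> sets \<mu>"
proof -
  have "{x \<in> space \<mu>. norm x < R} \<in> sets \<mu>"
    by measurable
  then show ?thesis by (simp add: space_\<mu>)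
qed

lemma ball_finite: "emeasure \<mu> {x \<in> I. norm x < R} < \<infinity>"
proof -
  have "bounded {x \<in> I. norm x < R}"
    by (rule bounded_subset[OF bounded_ball[of 0 R]]) auto
  then show ?thesis
    using \<mu>(2) ball_sets by (auto simp: finite_on_bounded_def)
qed

lemma interval_sets: "{-a<..<a} \<inter> J \<in> sets \<nu>"
proof -
  have "{t \<in> space \<nu>. -a < t \<and> t < a} \<in> sets \<nu>"
    by measurable
  moreover have "{t \<in> space \<nu>. -a < t \<and> t < a} = {-a<..<a} \<inter> J"
    by (auto simp: space_\<nu>)
  ultimately show ?thesis by simp
qed

section \<open>Linearity and bounds of translations and averages\<close>

lemma T_in [intro]: "t \<in> J \<Longrightarrow> f \<in> L \<Longrightarrow> T t f \<in> L"
  using T(1) unfolding translation_def by blast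

lemma T_linear_AE:
  "t \<in> J \<Longrightarrow> f \<in> L \<Longrightarrow> g \<in> L \<Longrightarrow> AE x in \<mu>. T t (\<lambda>y. c * f y + g y) x = c * T t f x + T t g x"
  using T(1) unfolding translation_def by blast

lemma T_linear_AE_time:
  "x \<in> I \<Longrightarrow> f \<in> L \<Longrightarrow> g \<in> L \<Longrightarrow> AE t in \<nu>. T t (\<lambda>y. c * f y + g y) x = c * T t f x + T t g x"
  using T(1) unfolding translation_def by blast

lemma T_0: "f \<in> L \<Longrightarrow> nrm (\<lambda>x. T 0 f x - f x) = 0"
  using T(1) unfolding translation_def by blast

lemma T_tendsto: "f \<in> L \<Longrightarrow> ((\<lambda>t. nrm (\<lambda>x. T t f x - f x)) \<longlongrightarrow> 0) (at 0 within J)"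
  using T(1) unfolding translation_def by blast

lemma T_measurable: "f \<in> L \<Longrightarrow> (\<lambda>(x, t). T t f x) \<in> borel_measurable (\<mu> \<Otimes>\<^sub>M \<nu>)"
  using T(1) unfolding translation_def by blast

lemma T_integrable: "f \<in> L \<Longrightarrow> 0 < a \<Longrightarrow> x \<in> I \<Longrightarrow> set_integrable \<nu> ({-a<..<a} \<inter> J) (\<lambda>t. T t f x)"
  using T(1) unfolding translation_def by blast

lemma zero_L: "(\<lambda>x. 0) \<in> L"
  by (simp add: Lp_def)

lemma T_diff_AE:
  assumes "t \<in> J" "f \<in> L" "g \<in> L"
  shows "AE x in \<mu>. T t (\<lambda>y. f y - g y) x = T t f x - T t g x"
  using T_linear_AE[OF assms(1,3,2), of "-1"] by simp

lemma T_scaleR_AE: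
  assumes "t \<in> J" "f \<in> L"
  shows "AE x in \<mu>. T t (\<lambda>y. c *\<^sub>R f y) x = c *\<^sub>R T t f x"
proof -
  have "AE x in \<mu>. T t (\<lambda>y. 0) x = 0"
    using T_linear_AE[OF assms(1) zero_L zero_L, of 1] by simp
  moreover have "AE x in \<mu>. T t (\<lambda>y. c *\<^sub>R f y) x = c *\<^sub>R T t f x + T t (\<lambda>y. 0) x"
    using T_linear_AE[OF assms zero_L, of "of_real c"] by (simp add: scaleR_conv_of_real)
  ultimately show ?thesis
    by eventually_elim simp
qed

text \<open>Homogeneity extends the bound from the unit ball. The scaling factor is 1/r for any r >
  0 with \<open>nrm f \<le> r\<close>, because \<open>nrm f\<close> itself may be 0. The final
  constant is made positive so that it can be divided by later.\<close>

lemma T_bound: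
  "\<exists>B>0. \<forall>t\<in>J. \<forall>f\<in>L. nrm (T t f) \<le> B * nrm f"
proof -
  obtain B where B: "\<And>t f. t \<in> J \<Longrightarrow> f \<in> L \<Longrightarrow> nrm f \<le> 1 \<Longrightarrow> nrm (T t f) \<le> B"
    using T(2) unfolding bounded_translation_def bdd_above_def by blast
  have B0: "0 \<le> B"
    using order_trans[OF Lp_norm_nonneg B[OF J0 zero_L]] by (simp add: Lp_norm_def)
  have le: "nrm (T t f) \<le> B * r" if t: "t \<in> J" and f: "f \<in> L" and r: "0 < r" "nrm f \<le> r" for t f r
  proof -
    have "nrm (\<lambda>y. (1 / r) *\<^sub>R f y) \<le> 1"
      using r by (subst Lp_norm_scaleR[OF p_pos]) auto
    then have "nrm (T t (\<lambda>y. (1 / r) *\<^sub>R f y)) \<le> B"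
      by (intro B t Lp_scaleR f)
    moreover have "nrm (T t (\<lambda>y. (1 / r) *\<^sub>R f y)) = nrm (\<lambda>x. (1 / r) *\<^sub>R T t f x)"
      by (intro Lp_norm_cong_AE T_scaleR_AE t f Lp_measurable[where p = p] Lp_scaleR T_in)
    ultimately show ?thesis
      using r by (simp add: Lp_norm_scaleR[OF p_pos] field_simps)
  qed
  have "nrm (T t f) \<le> (B + 1) * nrm f" if t: "t \<in> J" and f: "f \<in> L" for t f
  proof (rule order_trans)
    show "nrm (T t f) \<le> B * nrm f"
    proof (rule field_le_epsilon)
      fix e :: real
      assume e: "0 < e"
      \<comment> \<open>The radius exceeds \<open>nrm f\<close> slightly; the denominator
        \<open>B + 1\<close> keeps the cost below \<open>e\<close> and is nonzero even if
        \<open>B\<close> is 0.\<close>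
      have "nrm (T t f) \<le> B * (nrm f + e / (B + 1))"
        using e B0 by (intro le t f) (auto intro: add_nonneg_pos)
      also have "\<dots> \<le> B * nrm f + e"
        using e B0 by (simp add: field_simps)
      finally show "nrm (T t f) \<le> B * nrm f + e" .
    qed
  qed (simp add: algebra_simps)
  then show ?thesis
    using B0 by (intro exI[of _ "B + 1"]) auto
qed

text \<open>Pass through \<open>T s g\<close> and \<open>T t g\<close>: the two outer terms are
  translates of f - g, which accounts for the factor \<open>2 * B\<close>.\<close>

lemma T_shift_approx:
  assumes B: "\<forall>t\<in>J. \<forall>f\<in>L. nrm (T t f) \<le> B * nrm f"
    and st: "s \<in> J" "t \<in> J" and f: "f \<in> L" and g: "g \<in> L"
  shows "nrm (\<lambda>x. T s f x - T t f x) \<le> 2 * B * nrm (\<lambda>x. f x - g x) + nrm (\<lambda>x. T s g x - T t g x)"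
proof -
  have *: "nrm (\<lambda>x. T r f x - T r g x) \<le> B * nrm (\<lambda>x. f x - g x)" if "r \<in> J" for r
  proof -
    have "nrm (\<lambda>x. T r f x - T r g x) = nrm (T r (\<lambda>y. f y - g y))"
      using T_diff_AE[OF that f g]
      by (intro Lp_norm_cong_AE Lp_measurable[where p = p] diff_L T_in that f g) auto
    also have "\<dots> \<le> B * nrm (\<lambda>x. f x - g x)"
      using B that diff_L[OF f g] by blast
    finally show ?thesis .
  qed
  have "nrm (\<lambda>x. T s f x - T t f x) \<le> nrm (\<lambda>x. T s f x - T s g x) + nrm (\<lambda>x. T s g x - T t f x)"
    by (intro Lp_norm_diff_triangle p T_in st f g)
  moreover have "nrm (\<lambda>x. T s g x - T t f x) \<le> nrm (\<lambda>x. T s g x - T t g x) + nrm (\<lambda>x. T t g x - T t f x)"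
    by (intro Lp_norm_diff_triangle p T_in st f g)
  ultimately show ?thesis
    using *[OF st(1)] *[OF st(2)] Lp_norm_minus_commute[of \<mu> p "T t g" "T t f"] by simp
qed

text \<open>Additivity of each \<open>T t\<close> almost everywhere in space would say nothing at a
  prescribed point. Linearity for almost every time at that point is what survives integration in
  \<open>t\<close>.\<close>

lemma avg_diff:
  assumes f: "f \<in> L" and g: "g \<in> L" and x: "x \<in> I" and a: "0 < a"
  shows "Av a R (\<lambda>y. f y - g y) x = Av a R f x - Av a R g x"
proof -
  let ?S = "{-a<..<a} \<inter> J"
  have int: "integrable \<nu> (\<lambda>t. indicator ?S t *\<^sub>R T t h x)" if "h \<in> L" for h
    using T_integrable[OF that a x] by (simp add: set_integrable_def)
  have AE: "AE t in \<nu>. T t (\<lambda>y. f y - g y) x = T t f x - T t g x"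
    using T_linear_AE_time[OF x g f, of "-1"] by simp
  have "(LINT t:?S|\<nu>. T t (\<lambda>y. f y - g y) x)
      = (LINT t|\<nu>. indicator ?S t *\<^sub>R T t f x - indicator ?S t *\<^sub>R T t g x)"
    unfolding set_lebesgue_integral_def
  proof (rule integral_cong_AE)
    show "AE t in \<nu>. indicator ?S t *\<^sub>R T t (\<lambda>y. f y - g y) x
        = indicator ?S t *\<^sub>R T t f x - indicator ?S t *\<^sub>R T t g x"
      using AE by eventually_elim (simp add: scaleR_diff_right)
  qed (use int[OF f] int[OF g] int[OF diff_L[OF f g]] in \<open>auto intro!: borel_measurable_integrable\<close>)
  also have "\<dots> = (LINT t:?S|\<nu>. T t f x) - (LINT t:?S|\<nu>. T t g x)"
    unfolding set_lebesgue_integral_def by (rule Bochner_Integration.integral_diff[OF int int]) fact+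
  finally show ?thesis
    by (simp add: avg_def scaleR_diff_right)
qed

lemma avg_bound:
  assumes "0 < a" "0 < R"
  shows "\<exists>C>0. \<forall>f\<in>L. \<forall>x\<in>I. norm (Av a R f x) \<le> C * nrm f"
proof -
  obtain C where C: "\<forall>f\<in>L. \<forall>x\<in>I. norm (Av a R f x) \<le> C * nrm f"
    using T(3)[unfolded regular_translation_def, THEN conjunct2, THEN conjunct2, rule_format, OF assms]
    by (rule exE)
  have "C * nrm f \<le> (\<bar>C\<bar> + 1) * nrm f" for f
    by (intro mult_right_mono) auto
  with C have "\<forall>f\<in>L. \<forall>x\<in>I. norm (Av a R f x) \<le> (\<bar>C\<bar> + 1) * nrm f"
    by (meson order_trans)
  then show ?thesis
    by (intro exI[of _ "\<bar>C\<bar> + 1"]) auto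
qed

text \<open>The pointwise counterpart of \<open>T_shift_approx\<close>; the bound (T3) applied to f
  - g replaces the bound on \<open>T\<close>.\<close>

lemma avg_shift_approx:
  assumes C: "\<forall>f\<in>L. \<forall>x\<in>I. norm (Av a R f x) \<le> C * nrm f"
    and a: "0 < a" and xy: "x \<in> I" "y \<in> I" and f: "f \<in> L" and g: "g \<in> L"
  shows "norm (Av a R f y - Av a R f x) \<le> 2 * C * nrm (\<lambda>x. f x - g x) + norm (Av a R g y - Av a R g x)"
proof -
  have *: "norm (Av a R f z - Av a R g z) \<le> C * nrm (\<lambda>x. f x - g x)" if "z \<in> I" for z
    using C diff_L[OF f g] that avg_diff[OF f g that a] by (metis (no_types, lifting))
  have "dist (Av a R f y) (Av a R f x) \<le> dist (Av a R f y) (Av a R g y)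
      + dist (Av a R g y) (Av a R g x) + dist (Av a R g x) (Av a R f x)"
    using dist_triangle[of "Av a R f y" "Av a R f x" "Av a R g y"]
      dist_triangle[of "Av a R g y" "Av a R f x" "Av a R g x"] by linarith
  then show ?thesis
    using *[OF xy(1)] *[OF xy(2)] by (simp add: dist_norm norm_minus_commute)
qed

lemma avg_measurable:
  assumes f: "f \<in> L"
  shows "Av a R f \<in> borel_measurable \<mu>"
proof -
  have "(\<lambda>z. T (snd z) f (fst z)) \<in> borel_measurable (\<mu> \<Otimes>\<^sub>M \<nu>)"
    using T_measurable[OF f] by (simp add: case_prod_unfold)
  then have [measurable]: "(\<lambda>z. indicator ({-a<..<a} \<inter> J) (snd z) *\<^sub>R T (snd z) f (fst z)) \<in> borel_measurable (\<mu> \<Otimes>\<^sub>M \<nu>)"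
    using interval_sets by measurable
  have [measurable]: "(\<lambda>x. LINT t:({-a<..<a} \<inter> J)|\<nu>. T t f x) \<in> borel_measurable \<mu>"
    unfolding set_lebesgue_integral_def
    by (rule \<nu>.borel_measurable_lebesgue_integral) (simp add: case_prod_unfold)
  have "(\<lambda>x. Av a R f x) \<in> borel_measurable \<mu>"
    unfolding avg_def by measurable
  then show ?thesis .
qed

lemma avg_in_L:
  assumes f: "f \<in> L" and aR: "0 < a" "0 < R"
  shows "Av a R f \<in> L"
proof -
  obtain C where C: "0 < C" "\<forall>f\<in>L. \<forall>x\<in>I. norm (Av a R f x) \<le> C * nrm f"
    using avg_bound[OF aR] by blast
  show ?thesis
  proof (rule Lp_bounded_support[OF p_pos avg_measurable[OF f] ball_sets ball_finite])
    show "0 \<le> C * nrm f"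
      using C(1) by simp
    show "norm (Av a R f x) \<le> C * nrm f" if "x \<in> {x \<in> I. norm x < R}" for x
      using C(2) f that by simp
    show "Av a R f x = 0" if "x \<in> space \<mu> - {x \<in> I. norm x < R}" for x
      using that by (simp add: avg_def space_\<mu>)
  qed
qed

section \<open>Tails and equivanishing\<close>

lemma tail_measurable:
  assumes "f \<in> L"
  shows "(\<lambda>x. indicator {x. R < norm x} x *\<^sub>R f x) \<in> borel_measurable \<mu>"
proof -
  have [measurable]: "f \<in> borel_measurable \<mu>"
    using assms by (rule Lp_measurable)
  have "(\<lambda>x. if R < norm x then f x else 0) \<in> borel_measurable \<mu>"
    by measurable
  then show ?thesis
    by (simp add: indicator_scaleR_eq_if)
qed

lemma tail_in_L: "f \<in> L \<Longrightarrow> (\<lambda>x. indicator {x. R < norm x} x *\<^sub>R f x) \<in> L"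
  by (rule Lp_mono[OF p_pos _ tail_measurable]) (auto simp: indicator_def)

lemma tail_le: "f \<in> L \<Longrightarrow> nrm (\<lambda>x. indicator {x. R < norm x} x *\<^sub>R f x) \<le> nrm f"
  by (rule Lp_norm_mono[OF p_pos _ tail_measurable]) (auto simp: indicator_def)

text \<open>Writes the tail integral as the norm of a cut-off function, to which Minkowski's
  inequality applies.\<close>

lemma equivanishing_iff:
  fixes K :: "('a \<Rightarrow> 'b) set"
  shows "equivanishing I p \<mu> K \<longleftrightarrow>
    (\<forall>e>0. \<exists>R>0. \<forall>f\<in>K. nrm (\<lambda>x. indicator {x. R < norm x} x *\<^sub>R f x) < e)"
proof -
  have "(LINT x:(I - {x \<in> I. norm x \<le> R})|\<mu>. norm (f x) powr p)
      = (LINT x|\<mu>. norm (indicator {x. R < norm x} x *\<^sub>R f x) powr p)" for R :: real and f :: "'a \<Rightarrow> 'b"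
    unfolding set_lebesgue_integral_def
    using p by (intro Bochner_Integration.integral_cong refl) (auto simp: space_\<mu> indicator_def)
  then show ?thesis
    by (simp add: equivanishing_def Lp_norm_def)
qed

text \<open>Dominated convergence: at each point the cut-off function is eventually 0.\<close>

lemma tail_tendsto:
  assumes f: "f \<in> L"
  shows "(\<lambda>n. nrm (\<lambda>x. indicator {x. real n < norm x} x *\<^sub>R f x)) \<longlonglongrightarrow> 0"
proof -
  have [measurable]: "(\<lambda>x. indicator {x. real n < norm x} x *\<^sub>R f x) \<in> borel_measurable \<mu>" for n
    by (rule tail_measurable[OF f])
  have "(\<lambda>n. LINT x|\<mu>. norm (indicator {x. real n < norm x} x *\<^sub>R f x) powr p) \<longlonglongrightarrow> (LINT x|\<mu>. 0)"
  proof (rule integral_dominated_convergence[where w = "\<lambda>x. norm (f x) powr p"])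
    show "integrable \<mu> (\<lambda>x. norm (f x) powr p)"
      using f by (simp add: Lp_def)
    show "AE x in \<mu>. (\<lambda>n. norm (indicator {x. real n < norm x} x *\<^sub>R f x) powr p) \<longlonglongrightarrow> 0"
    proof (rule AE_I2)
      fix x :: 'a
      obtain N where N: "norm x \<le> real N"
        using real_arch_simple by blast
      have "\<forall>\<^sub>F n in sequentially. norm (indicator {x. real n < norm x} x *\<^sub>R f x) powr p = 0"
        using eventually_ge_at_top[of N] by eventually_elim (use N in \<open>auto simp: indicator_def\<close>)
      then show "(\<lambda>n. norm (indicator {x. real n < norm x} x *\<^sub>R f x) powr p) \<longlonglongrightarrow> 0"
        by (rule tendsto_eventually)
    qed
    show "AE x in \<mu>. norm (norm (indicator {x. real n < norm x} x *\<^sub>R f x) powr p) \<le> norm (f x) powr p" for n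
      by (rule AE_I2) (auto simp: indicator_def)
  qed measurable
  then have "(\<lambda>n. (LINT x|\<mu>. norm (indicator {x. real n < norm x} x *\<^sub>R f x) powr p) powr (1 / p)) \<longlonglongrightarrow> 0 powr (1 / p)"
    using p by (intro tendsto_powr') auto
  then show ?thesis
    by (simp add: Lp_norm_def)
qed

text \<open>Cutting off is linear and does not increase the norm, so a radius good for the finitely
  many centres with e/2 is good for \<open>K\<close> with e.\<close>

lemma finite_nets_imp_equivanishing:
  assumes K: "K \<subseteq> L" and net: "\<And>e. 0 < e \<Longrightarrow> \<exists>F\<subseteq>K. finite F \<and> (\<forall>f\<in>K. \<exists>g\<in>F. nrm (\<lambda>x. f x - g x) < e)"
  shows "equivanishing I p \<mu> K"
  unfolding equivanishing_iff
proof (intro allI impI)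
  fix e :: real
  assume e: "0 < e"
  obtain F where F: "F \<subseteq> K" "finite F" "\<And>f. f \<in> K \<Longrightarrow> \<exists>g\<in>F. nrm (\<lambda>x. f x - g x) < e / 2"
    using net[of "e / 2"] e by auto
  let ?tail = "\<lambda>(R::real) (f :: 'a \<Rightarrow> 'b) x. indicator {x. R < norm x} x *\<^sub>R f x"
  have "\<forall>\<^sub>F n in sequentially. nrm (?tail (real n) g) < e / 2" if "g \<in> F" for g
    using tail_tendsto[of g] that F(1) K e by (intro order_tendstoD) auto
  then have "\<forall>\<^sub>F n in sequentially. \<forall>g\<in>F. nrm (?tail (real n) g) < e / 2"
    using F(2) by (intro eventually_ball_finite) auto
  then have "\<forall>\<^sub>F n in sequentially. 0 < n \<and> (\<forall>g\<in>F. nrm (?tail (real n) g) < e / 2)"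
    by (intro eventually_conj eventually_gt_at_top)
  then obtain n where n: "0 < n" "\<And>g. g \<in> F \<Longrightarrow> nrm (?tail (real n) g) < e / 2"
    using eventually_happens'[OF sequentially_bot] by blast
  have "nrm (?tail (real n) f) < e" if f: "f \<in> K" for f
  proof -
    obtain g where g: "g \<in> F" "nrm (\<lambda>x. f x - g x) < e / 2"
      using F(3)[OF f] by blast
    have L: "f \<in> L" "g \<in> L"
      using f g F(1) K by auto
    have "nrm (?tail (real n) f) = nrm (\<lambda>x. ?tail (real n) (\<lambda>x. f x - g x) x + ?tail (real n) g x)"
      by (simp add: scaleR_diff_right)
    also have "\<dots> \<le> nrm (?tail (real n) (\<lambda>x. f x - g x)) + nrm (?tail (real n) g)"
      by (intro Lp_norm_triangle p tail_in_L diff_L L)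
    also have "\<dots> < e"
      using tail_le[OF diff_L[OF L], of "real n"] g(2) n(2)[OF g(1)] by linarith
    finally show ?thesis .
  qed
  then show "\<exists>R>0. \<forall>f\<in>K. nrm (?tail R f) < e"
    using n(1) by (intro exI[of _ "real n"]) auto
qed

section \<open>From finite nets to equicontinuity in mean\<close>

text \<open>(T1) speaks of t > 0 only. At t = 0 continuity comes from the initial condition in the
  L^p norm.\<close>

lemma T_shift_continuous_dense:
  assumes E: "Lp_dense \<mu> p E" and g: "g \<in> E"
    and T1: "\<And>M \<epsilon>. 0 < M \<Longrightarrow> 0 < \<epsilon> \<Longrightarrow> \<exists>\<delta>>0. \<forall>t h. 0 < t \<and> t < M \<and> \<bar>h\<bar> \<le> \<delta> \<and> t \<in> J \<and> t + h \<in> J \<longrightarrow>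
           nrm (\<lambda>x. T (t + h) g x - T t g x) < \<epsilon>"
    and J: "J \<subseteq> {0..}" and M: "0 < M" and e: "0 < \<epsilon>"
  shows "\<exists>\<delta>>0. \<forall>t\<in>{-M<..<M} \<inter> J. \<forall>h. \<bar>h\<bar> \<le> \<delta> \<and> t + h \<in> J \<longrightarrow> nrm (\<lambda>x. T (t + h) g x - T t g x) < \<epsilon>"
proof -
  have gL: "g \<in> L"
    using E g by (auto simp: Lp_dense_def)
  obtain d1 where d1: "0 < d1" "\<And>t h. 0 < t \<and> t < M \<and> \<bar>h\<bar> \<le> d1 \<and> t \<in> J \<and> t + h \<in> J \<longrightarrow>
      nrm (\<lambda>x. T (t + h) g x - T t g x) < \<epsilon>"
    using T1[OF M e] by blast
  have "\<forall>\<^sub>F t in at 0 within J. nrm (\<lambda>x. T t g x - g x) < \<epsilon>"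
    using T_tendsto[OF gL] e by (rule order_tendstoD)
  then obtain d2 where d2: "0 < d2" "\<And>t. t \<in> J \<Longrightarrow> t \<noteq> 0 \<Longrightarrow> \<bar>t\<bar> < d2 \<Longrightarrow> nrm (\<lambda>x. T t g x - g x) < \<epsilon>"
    unfolding eventually_at dist_real_def by auto
  \<comment> \<open>The limit leaves out h = 0, and \<open>T 0 g\<close> is tied to \<open>g\<close>
    only by a vanishing norm; so the comparison goes through \<open>g\<close>.\<close>
  have at0: "nrm (\<lambda>x. T h g x - T 0 g x) < \<epsilon>" if h: "h \<in> J" "\<bar>h\<bar> < d2" for h
  proof -
    have "nrm (\<lambda>x. T h g x - T 0 g x) \<le> nrm (\<lambda>x. T h g x - g x) + nrm (\<lambda>x. g x - T 0 g x)"
      by (intro Lp_norm_diff_triangle p T_in J0 h gL)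
    also have "nrm (\<lambda>x. g x - T 0 g x) = 0"
      using T_0[OF gL] by (simp add: Lp_norm_minus_commute[of _ _ g])
    also have "nrm (\<lambda>x. T h g x - g x) + 0 < \<epsilon>"
      using d2(2)[OF h(1) _ h(2)] T_0[OF gL] e by (cases "h = 0") auto
    finally show ?thesis .
  qed
  \<comment> \<open>\<open>d2\<close> is halved because \<open>at0\<close> asks for a strict
    inequality, whereas the shift satisfies a weak one.\<close>
  show ?thesis
  proof (intro exI[of _ "min d1 (d2 / 2)"] conjI ballI allI impI)
    show "0 < min d1 (d2 / 2)"
      using d1 d2 by simp
    fix t h
    assume t: "t \<in> {-M<..<M} \<inter> J" and h: "\<bar>h\<bar> \<le> min d1 (d2 / 2) \<and> t + h \<in> J"
    show "nrm (\<lambda>x. T (t + h) g x - T t g x) < \<epsilon>"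
    proof (cases "t = 0")
      case True
      then show ?thesis
        using at0[of h] h d2(1) by auto
    next
      case False
      then have "0 < t"
        using t J by force
      then show ?thesis
        using d1(2)[of t h] t h by auto
    qed
  qed
qed

text \<open>The approximating sets range over L^p rather than over \<open>K\<close>, so the lemma
  serves twice: with a singleton \<open>K\<close> and one function from the dense set of (T1), and
  then with the given \<open>K\<close> and its nets.\<close>

lemma T_shift_continuous_limit:
  assumes approx: "\<And>e. 0 < e \<Longrightarrow> \<exists>F\<subseteq>L. finite F \<and> (\<forall>f\<in>K. \<exists>g\<in>F. nrm (\<lambda>x. f x - g x) < e) \<and>
      (\<forall>g\<in>F. \<forall>\<epsilon>>0. \<exists>\<delta>>0. \<forall>t\<in>{-M<..<M} \<inter> J. \<forall>h. \<bar>h\<bar> \<le> \<delta> \<and> t + h \<in> J \<longrightarrow>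
        nrm (\<lambda>x. T (t + h) g x - T t g x) < \<epsilon>)"
    and K: "K \<subseteq> L" and e: "0 < \<epsilon>"
  shows "\<exists>\<delta>>0. \<forall>t\<in>{-M<..<M} \<inter> J. \<forall>h. \<forall>f\<in>K. \<bar>h\<bar> \<le> \<delta> \<and> t + h \<in> J \<longrightarrow>
    nrm (\<lambda>x. T (t + h) f x - T t f x) < \<epsilon>"
proof -
  obtain B where B: "0 < B" "\<forall>t\<in>J. \<forall>f\<in>L. nrm (T t f) \<le> B * nrm f"
    using T_bound by blast
  \<comment> \<open>Chosen so that \<open>2 * B * e'\<close> is half of \<open>\<epsilon>\<close>;
    the centres account for the other half.\<close>
  define e' where "e' = \<epsilon> / (4 * B)"
  have "0 < e'"
    using B(1) e by (simp add: e'_def)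
  from approx[OF this] obtain F where F: "F \<subseteq> L" "finite F" "\<forall>f\<in>K. \<exists>g\<in>F. nrm (\<lambda>x. f x - g x) < e'"
      "\<forall>g\<in>F. \<forall>\<epsilon>>0. \<exists>\<delta>>0. \<forall>t\<in>{-M<..<M} \<inter> J. \<forall>h. \<bar>h\<bar> \<le> \<delta> \<and> t + h \<in> J \<longrightarrow>
        nrm (\<lambda>x. T (t + h) g x - T t g x) < \<epsilon>"
    by blast
  have e2: "0 < \<epsilon> / 2"
    using e by simp
  have "\<exists>\<delta>>0. \<forall>g\<in>F. \<forall>t\<in>{-M<..<M} \<inter> J. \<forall>h. \<bar>h\<bar> \<le> \<delta> \<and> t + h \<in> J \<longrightarrow>
      nrm (\<lambda>x. T (t + h) g x - T t g x) < \<epsilon> / 2"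
  proof (rule finite_uniform_delta[OF F(2)])
    fix g assume "g \<in> F"
    with F(4) e2 show "\<exists>\<delta>>0. \<forall>t\<in>{-M<..<M} \<inter> J. \<forall>h. \<bar>h\<bar> \<le> \<delta> \<and> t + h \<in> J \<longrightarrow>
      nrm (\<lambda>x. T (t + h) g x - T t g x) < \<epsilon> / 2" by blast
  qed force
  then obtain d where d: "0 < d" "\<And>g t h. g \<in> F \<Longrightarrow> t \<in> {-M<..<M} \<inter> J \<Longrightarrow> \<bar>h\<bar> \<le> d \<Longrightarrow> t + h \<in> J \<Longrightarrow>
      nrm (\<lambda>x. T (t + h) g x - T t g x) < \<epsilon> / 2"
    by blast
  have "nrm (\<lambda>x. T (t + h) f x - T t f x) < \<epsilon>"
    if t: "t \<in> {-M<..<M} \<inter> J" and h: "\<bar>h\<bar> \<le> d" "t + h \<in> J" and f: "f \<in> K" for t h f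
  proof -
    obtain g where g: "g \<in> F" "nrm (\<lambda>x. f x - g x) < e'"
      using F(3) f by blast
    have "nrm (\<lambda>x. T (t + h) f x - T t f x)
        \<le> 2 * B * nrm (\<lambda>x. f x - g x) + nrm (\<lambda>x. T (t + h) g x - T t g x)"
      using t h f g F(1) K by (intro T_shift_approx B(2)) auto
    also have "\<dots> < 2 * B * e' + \<epsilon> / 2"
      using B(1) g(2) by (intro add_strict_mono d g t h) auto
    also have "\<dots> = \<epsilon>"
      using B(1) by (simp add: e'_def)
    finally show ?thesis .
  qed
  with d(1) show ?thesis
    by (intro exI[of _ d]) auto
qed

text \<open>The same scheme with the constant of (T3), which depends on \<open>a\<close> and
  \<open>R\<close>; these stay fixed throughout.\<close>

lemma avg_shift_continuous_limit:
  assumes approx: "\<And>e. 0 < e \<Longrightarrow> \<exists>F\<subseteq>L. finite F \<and> (\<forall>f\<in>K. \<exists>g\<in>F. nrm (\<lambda>x. f x - g x) < e) \<and>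
      (\<forall>g\<in>F. \<forall>\<epsilon>>0. \<exists>\<delta>>0. \<forall>x h. norm h \<le> \<delta> \<and> x \<in> I \<and> x + h \<in> I \<and> norm x < R \<and> norm (x + h) < R \<longrightarrow>
        norm (Av a R g (x + h) - Av a R g x) < \<epsilon>)"
    and aR: "0 < a" "0 < R" and K: "K \<subseteq> L" and e: "0 < \<epsilon>"
  shows "\<exists>\<delta>>0. \<forall>x h. \<forall>f\<in>K. norm h \<le> \<delta> \<and> x \<in> I \<and> x + h \<in> I \<and> norm x < R \<and> norm (x + h) < R \<longrightarrow>
        norm (Av a R f (x + h) - Av a R f x) < \<epsilon>"
proof -
  obtain C where C: "0 < C" "\<forall>f\<in>L. \<forall>x\<in>I. norm (Av a R f x) \<le> C * nrm f"
    using avg_bound[OF aR] by blast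
  define e' where "e' = \<epsilon> / (4 * C)"
  have "0 < e'"
    using C(1) e by (simp add: e'_def)
  from approx[OF this] obtain F where F: "F \<subseteq> L" "finite F" "\<forall>f\<in>K. \<exists>g\<in>F. nrm (\<lambda>x. f x - g x) < e'"
      "\<forall>g\<in>F. \<forall>\<epsilon>>0. \<exists>\<delta>>0. \<forall>x h. norm h \<le> \<delta> \<and> x \<in> I \<and> x + h \<in> I \<and> norm x < R \<and> norm (x + h) < R \<longrightarrow>
        norm (Av a R g (x + h) - Av a R g x) < \<epsilon>"
    by blast
  have e2: "0 < \<epsilon> / 2"
    using e by simp
  have "\<exists>\<delta>>0. \<forall>g\<in>F. \<forall>x h. norm h \<le> \<delta> \<and> x \<in> I \<and> x + h \<in> I \<and> norm x < R \<and> norm (x + h) < R \<longrightarrow>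
        norm (Av a R g (x + h) - Av a R g x) < \<epsilon> / 2"
  proof (rule finite_uniform_delta[OF F(2)])
    fix g assume "g \<in> F"
    with F(4) e2 show "\<exists>\<delta>>0. \<forall>x h. norm h \<le> \<delta> \<and> x \<in> I \<and> x + h \<in> I \<and> norm x < R \<and> norm (x + h) < R \<longrightarrow>
        norm (Av a R g (x + h) - Av a R g x) < \<epsilon> / 2" by blast
  qed force
  then obtain d where d: "0 < d" "\<And>g x h. g \<in> F \<Longrightarrow> norm h \<le> d \<Longrightarrow> x \<in> I \<Longrightarrow> x + h \<in> I \<Longrightarrow>
      norm x < R \<Longrightarrow> norm (x + h) < R \<Longrightarrow> norm (Av a R g (x + h) - Av a R g x) < \<epsilon> / 2"
    by blast
  have "norm (Av a R f (x + h) - Av a R f x) < \<epsilon>"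
    if h: "norm h \<le> d" "x \<in> I" "x + h \<in> I" "norm x < R" "norm (x + h) < R" and f: "f \<in> K" for x h f
  proof -
    obtain g where g: "g \<in> F" "nrm (\<lambda>x. f x - g x) < e'"
      using F(3) f by blast
    have "norm (Av a R f (x + h) - Av a R f x)
        \<le> 2 * C * nrm (\<lambda>x. f x - g x) + norm (Av a R g (x + h) - Av a R g x)"
      using h f g F(1) K aR by (intro avg_shift_approx C(2)) auto
    also have "\<dots> < 2 * C * e' + \<epsilon> / 2"
      using C(1) g(2) by (intro add_strict_mono d g h) auto
    also have "\<dots> = \<epsilon>"
      using C(1) by (simp add: e'_def)
    finally show ?thesis .
  qed
  with d(1) show ?thesis
    by (intro exI[of _ d]) auto
qed

text \<open>The dense sets of (T1) and (T2) may differ, so the two halves are treated independently,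
  each first for a single function in L^p and then for \<open>K\<close>.\<close>

lemma finite_nets_imp_equicontinuous_in_mean:
  assumes J: "J \<subseteq> {0..}" and K: "K \<subseteq> L"
    and net: "\<And>e. 0 < e \<Longrightarrow> \<exists>F\<subseteq>K. finite F \<and> (\<forall>f\<in>K. \<exists>g\<in>F. nrm (\<lambda>x. f x - g x) < e)"
  shows "equicontinuous_in_mean I J p \<mu> \<nu> T K"
proof -
  obtain E1 where E1: "Lp_dense \<mu> p E1"
      "\<forall>g\<in>E1. \<forall>M>0. \<forall>\<epsilon>>0. \<exists>\<delta>>0. \<forall>t h. 0 < t \<and> t < M \<and> \<bar>h\<bar> \<le> \<delta> \<and> t \<in> J \<and> t + h \<in> J \<longrightarrow>
           nrm (\<lambda>x. T (t + h) g x - T t g x) < \<epsilon>"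
    using T(3)[unfolded regular_translation_def, THEN conjunct1] by (elim exE conjE)
  obtain E2 where E2: "Lp_dense \<mu> p E2"
      "\<forall>g\<in>E2. \<forall>\<epsilon>>0. \<forall>a>0. \<forall>R>0. \<exists>\<delta>>0. \<forall>x h.
           norm h \<le> \<delta> \<and> x \<in> I \<and> x + h \<in> I \<and> norm x < R \<and> norm (x + h) < R \<longrightarrow>
           norm (Av a R g (x + h) - Av a R g x) < \<epsilon>"
    using T(3)[unfolded regular_translation_def, THEN conjunct2, THEN conjunct1] by (elim exE conjE)
  \<comment> \<open>Density in the form that the limit lemmas expect: one nearby function is a net
    for the singleton.\<close>
  have dense: "\<exists>F\<subseteq>L. finite F \<and> (\<forall>f\<in>{f}. \<exists>g\<in>F. nrm (\<lambda>x. f x - g x) < e) \<and> (\<forall>g\<in>F. P g)"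
    if E: "Lp_dense \<mu> p E" and P: "\<And>g. g \<in> E \<Longrightarrow> P g" and f: "f \<in> L" and e: "0 < e" for E P f e
  proof -
    obtain g where "g \<in> E" "nrm (\<lambda>x. f x - g x) < e"
      using E f e unfolding Lp_dense_def by meson
    then show ?thesis
      using E P by (intro exI[of _ "{g}"]) (auto simp: Lp_dense_def)
  qed
  have T_cont: "\<exists>\<delta>>0. \<forall>t\<in>{-M<..<M} \<inter> J. \<forall>h. \<bar>h\<bar> \<le> \<delta> \<and> t + h \<in> J \<longrightarrow> nrm (\<lambda>x. T (t + h) f x - T t f x) < \<epsilon>"
    if f: "f \<in> L" and M: "0 < M" and e: "0 < \<epsilon>" for f M \<epsilon>
  proof -
    have "\<forall>\<epsilon>>0. \<exists>\<delta>>0. \<forall>t\<in>{-M<..<M} \<inter> J. \<forall>h. \<bar>h\<bar> \<le> \<delta> \<and> t + h \<in> J \<longrightarrow> nrm (\<lambda>x. T (t + h) g x - T t g x) < \<epsilon>"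
      if g: "g \<in> E1" for g
      using E1(2)[rule_format, OF g] by (intro allI impI T_shift_continuous_dense[OF E1(1) g _ J M])
    then have "\<exists>\<delta>>0. \<forall>t\<in>{-M<..<M} \<inter> J. \<forall>h. \<forall>f\<in>{f}. \<bar>h\<bar> \<le> \<delta> \<and> t + h \<in> J \<longrightarrow>
        nrm (\<lambda>x. T (t + h) f x - T t f x) < \<epsilon>"
      by (intro T_shift_continuous_limit[OF dense[OF E1(1) _ f]]) (use f e in auto)
    then show ?thesis
      by simp
  qed
  have Av_cont: "\<exists>\<delta>>0. \<forall>x h. norm h \<le> \<delta> \<and> x \<in> I \<and> x + h \<in> I \<and> norm x < R \<and> norm (x + h) < R \<longrightarrow>
        norm (Av a R f (x + h) - Av a R f x) < \<epsilon>"
    if f: "f \<in> L" and aR: "0 < a" "0 < R" and e: "0 < \<epsilon>" for f a R \<epsilon>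
  proof -
    have "\<forall>\<epsilon>>0. \<exists>\<delta>>0. \<forall>x h. norm h \<le> \<delta> \<and> x \<in> I \<and> x + h \<in> I \<and> norm x < R \<and> norm (x + h) < R \<longrightarrow>
        norm (Av a R g (x + h) - Av a R g x) < \<epsilon>" if g: "g \<in> E2" for g
      using E2(2) g aR by simp
    then have "\<exists>\<delta>>0. \<forall>x h. \<forall>f\<in>{f}. norm h \<le> \<delta> \<and> x \<in> I \<and> x + h \<in> I \<and> norm x < R \<and> norm (x + h) < R \<longrightarrow>
        norm (Av a R f (x + h) - Av a R f x) < \<epsilon>"
      by (intro avg_shift_continuous_limit[OF dense[OF E2(1) _ f] aR]) (use f e in auto)
    then show ?thesis
      by simp
  qed
  show ?thesis
    unfolding equicontinuous_in_mean_def
  proof (intro conjI allI impI)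
    fix \<epsilon> M :: real
    assume "0 < \<epsilon>" "0 < M"
    show "\<exists>\<delta>>0. \<forall>t\<in>{-M<..<M} \<inter> J. \<forall>h. \<forall>f\<in>K. \<bar>h\<bar> \<le> \<delta> \<and> t + h \<in> J \<longrightarrow>
        nrm (\<lambda>x. T (t + h) f x - T t f x) < \<epsilon>"
    proof (rule T_shift_continuous_limit[OF _ K \<open>0 < \<epsilon>\<close>])
      fix e :: real
      assume "0 < e"
      then obtain F where F: "F \<subseteq> K" "finite F" "\<forall>f\<in>K. \<exists>g\<in>F. nrm (\<lambda>x. f x - g x) < e"
        using net by blast
      moreover have "F \<subseteq> L"
        using F(1) K by blast
      ultimately show "\<exists>F\<subseteq>L. finite F \<and> (\<forall>f\<in>K. \<exists>g\<in>F. nrm (\<lambda>x. f x - g x) < e) \<and>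
          (\<forall>g\<in>F. \<forall>\<epsilon>>0. \<exists>\<delta>>0. \<forall>t\<in>{-M<..<M} \<inter> J. \<forall>h. \<bar>h\<bar> \<le> \<delta> \<and> t + h \<in> J \<longrightarrow>
            nrm (\<lambda>x. T (t + h) g x - T t g x) < \<epsilon>)"
        using T_cont[OF _ \<open>0 < M\<close>] by (intro exI[of _ F] conjI ballI allI impI) auto
    qed
  next
    fix \<epsilon> a R :: real
    assume "0 < \<epsilon>" "0 < a" "0 < R"
    show "\<exists>\<delta>>0. \<forall>x h. \<forall>f\<in>K. norm h \<le> \<delta> \<and> x \<in> I \<and> x + h \<in> I \<and> norm x < R \<and> norm (x + h) < R \<longrightarrow>
        norm (Av a R f (x + h) - Av a R f x) < \<epsilon>"
    proof (rule avg_shift_continuous_limit[OF _ \<open>0 < a\<close> \<open>0 < R\<close> K \<open>0 < \<epsilon>\<close>])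
      fix e :: real
      assume "0 < e"
      then obtain F where F: "F \<subseteq> K" "finite F" "\<forall>f\<in>K. \<exists>g\<in>F. nrm (\<lambda>x. f x - g x) < e"
        using net by blast
      moreover have "F \<subseteq> L"
        using F(1) K by blast
      ultimately show "\<exists>F\<subseteq>L. finite F \<and> (\<forall>f\<in>K. \<exists>g\<in>F. nrm (\<lambda>x. f x - g x) < e) \<and>
          (\<forall>g\<in>F. \<forall>\<epsilon>>0. \<exists>\<delta>>0. \<forall>x h. norm h \<le> \<delta> \<and> x \<in> I \<and> x + h \<in> I \<and> norm x < R \<and> norm (x + h) < R \<longrightarrow>
            norm (Av a R g (x + h) - Av a R g x) < \<epsilon>)"
        using Av_cont[OF _ \<open>0 < a\<close> \<open>0 < R\<close>] by (intro exI[of _ F] conjI ballI allI impI) auto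
    qed
  qed
qed

section \<open>From equivanishing and equicontinuity to finite nets\<close>

lemma avg_approximation:
  assumes f: "f \<in> L" and a: "0 < a" and R: "0 < R" and e: "0 \<le> e"
    and shift: "\<And>t. t \<in> {-a<..<a} \<inter> J \<Longrightarrow> nrm (\<lambda>x. T t f x - f x) \<le> e"
    and R': "R' < R"
  shows "nrm (\<lambda>x. Av a R f x - f x) \<le> e + nrm (\<lambda>x. indicator {x. R' < norm x} x *\<^sub>R f x)"
proof -
  let ?S = "{-a<..<a} \<inter> J"
  let ?tail = "\<lambda>x. indicator {x. R' < norm x} x *\<^sub>R f x"
  define A where "A = measure \<nu> ?S"
  have A: "0 < A"
    using \<nu>_pos[OF a] by (simp add: A_def)
  have S_fin: "emeasure \<nu> ?S = ennreal A"
    unfolding A_def using A by (intro emeasure_eq_ennreal_measure) (auto simp: A_def measure_def)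
  note [measurable] = Lp_measurable[OF f] interval_sets avg_measurable[OF f]
  \<comment> \<open>The constant \<open>f x\<close> has time average \<open>f x\<close>, so inside
    the ball the error is the time average of \<open>D x\<close>, and Jensen's inequality applies to
    it.\<close>
  define D where "D x t = indicator ?S t *\<^sub>R (T t f x - f x)" for x t
  have "(\<lambda>z. T (snd z) f (fst z)) \<in> borel_measurable (\<mu> \<Otimes>\<^sub>M \<nu>)"
    using T_measurable[OF f] by (simp add: case_prod_unfold)
  then have D_meas: "(\<lambda>z. D (fst z) (snd z)) \<in> borel_measurable (\<mu> \<Otimes>\<^sub>M \<nu>)"
    unfolding D_def by measurable
  then have D_powr_meas: "(\<lambda>(x, t). ennreal (norm (D x t) powr p)) \<in> borel_measurable (\<mu> \<Otimes>\<^sub>M \<nu>)"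
    by (simp add: case_prod_unfold)
  have pointwise: "ennreal (norm (Av a R f x - f x) powr p)
      \<le> ennreal (1 / A) * (\<integral>\<^sup>+t. ennreal (norm (D x t) powr p) \<partial>\<nu>)" if x: "x \<in> I" "norm x < R" for x
  proof -
    have int: "integrable \<nu> (\<lambda>t. indicator ?S t *\<^sub>R T t f x)"
      using T_integrable[OF f a x(1)] by (simp add: set_integrable_def)
    have int1: "integrable \<nu> (\<lambda>t. indicator ?S t *\<^sub>R f x)"
      using S_fin interval_sets by (intro integrable_scaleR_left integrable_real_indicator) auto
    have D_eq: "D x = (\<lambda>t. indicator ?S t *\<^sub>R T t f x - indicator ?S t *\<^sub>R f x)"
      by (simp add: D_def fun_eq_iff scaleR_diff_right)
    have intD: "integrable \<nu> (D x)"
      unfolding D_eq by (intro Bochner_Integration.integrable_diff int int1)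
    have "(LINT t|\<nu>. D x t) = (LINT t:?S|\<nu>. T t f x) - A *\<^sub>R f x"
    proof -
      have "(LINT t|\<nu>. indicator ?S t *\<^sub>R f x) = A *\<^sub>R f x"
        using S_fin interval_sets sets.sets_into_space[OF interval_sets, of a]
        by (subst integral_scaleR_left) (auto simp: A_def Int_absorb2)
      then show ?thesis
        unfolding D_eq set_lebesgue_integral_def
        by (subst Bochner_Integration.integral_diff[OF int int1]) simp
    qed
    then have "(1 / A) *\<^sub>R (LINT t|\<nu>. D x t) = Av a R f x - f x"
      using A x by (simp add: avg_def A_def scaleR_diff_right)
    moreover have "ennreal (norm ((1 / measure \<nu> ?S) *\<^sub>R (LINT t|\<nu>. D x t)) powr p)
        \<le> ennreal (1 / measure \<nu> ?S) * (\<integral>\<^sup>+t. ennreal (norm (D x t) powr p) \<partial>\<nu>)"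
      using p interval_sets \<nu>_pos[OF a] intD by (rule Jensen_norm_powr) (simp add: D_def)
    ultimately show ?thesis
      by (simp add: A_def)
  qed
  \<comment> \<open>Off the interval both sides are 0, so integration over \<open>t\<close> produces
    the factor \<open>A\<close> that cancels \<open>1 / A\<close>.\<close>
  have inner: "(\<integral>\<^sup>+x. ennreal (norm (D x t) powr p) \<partial>\<mu>) \<le> ennreal (e powr p) * indicator ?S t" for t
  proof (cases "t \<in> ?S")
    case True
    then have "(\<lambda>x. T t f x - f x) \<in> L"
      using f by (intro diff_L T_in) auto
    then have "(\<integral>\<^sup>+x. ennreal (norm (T t f x - f x) powr p) \<partial>\<mu>) \<le> ennreal (e powr p)"
      using shift[OF True] p by (subst nn_integral_Lp[OF _ p_pos]) (auto intro!: ennreal_leI powr_mono2)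
    then show ?thesis
      using True by (simp add: D_def)
  next
    case False
    then show ?thesis
      by (simp add: D_def)
  qed
  define h where "h x = (if norm x < R then Av a R f x - f x else 0)" for x
  have h_meas: "h \<in> borel_measurable \<mu>"
    unfolding h_def by measurable
  have "(\<integral>\<^sup>+x. ennreal (norm (h x) powr p) \<partial>\<mu>)
      \<le> (\<integral>\<^sup>+x. ennreal (1 / A) * (\<integral>\<^sup>+t. ennreal (norm (D x t) powr p) \<partial>\<nu>) \<partial>\<mu>)"
    using pointwise p by (intro nn_integral_mono) (auto simp: h_def space_\<mu>)
  also have "\<dots> = ennreal (1 / A) * (\<integral>\<^sup>+x. \<integral>\<^sup>+t. ennreal (norm (D x t) powr p) \<partial>\<nu> \<partial>\<mu>)"
    using \<nu>.borel_measurable_nn_integral[OF D_powr_meas] by (rule nn_integral_cmult)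
  also have "\<dots> = ennreal (1 / A) * (\<integral>\<^sup>+t. \<integral>\<^sup>+x. ennreal (norm (D x t) powr p) \<partial>\<mu> \<partial>\<nu>)"
    by (simp add: Fubini'[OF D_powr_meas])
  also have "\<dots> \<le> ennreal (1 / A) * (\<integral>\<^sup>+t. ennreal (e powr p) * indicator ?S t \<partial>\<nu>)"
    by (intro mult_left_mono nn_integral_mono inner) auto
  also have "\<dots> = ennreal (1 / A) * (ennreal (e powr p) * ennreal A)"
    using interval_sets S_fin by (simp add: nn_integral_cmult_indicator)
  also have "\<dots> = ennreal (e powr p)"
    using A by (simp add: ennreal_mult[symmetric])
  finally have h_le: "(\<integral>\<^sup>+x. ennreal (norm (h x) powr p) \<partial>\<mu>) \<le> ennreal (e powr p)" .
  have h: "h \<in> L" "nrm h \<le> e"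
    by (rule Lp_I[OF h_meas p_pos e h_le], rule Lp_norm_leI[OF h_meas p_pos e h_le])
  \<comment> \<open>Where the average is cut off the error is -f. Averages vanish on |x| \<ge> R and
    tails live on |x| > R', so the strict inequality R' < R is what keeps the sphere |x| = R inside
    the tail.\<close>
  define k where "k x = (if norm x < R then 0 else - f x)" for x
  have k_meas: "k \<in> borel_measurable \<mu>"
    unfolding k_def by measurable
  have k_le: "norm (k x) \<le> norm (?tail x)" for x
    using R' by (auto simp: k_def indicator_def)
  have k: "k \<in> L" "nrm k \<le> nrm ?tail"
    by (rule Lp_mono[OF p_pos tail_in_L[OF f] k_meas k_le], rule Lp_norm_mono[OF p_pos tail_in_L[OF f] k_meas k_le])
  have "(\<lambda>x. Av a R f x - f x) = (\<lambda>x. h x + k x)"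
    by (auto simp: h_def k_def avg_def)
  then have "nrm (\<lambda>x. Av a R f x - f x) \<le> nrm h + nrm k"
    using Lp_norm_triangle[OF p h(1) k(1)] by simp
  then show ?thesis
    using h(2) k(2) by linarith
qed

text \<open>The order of choices matters: the bound (T3) and the modulus of continuity of the
  averages depend on \<open>a\<close> and \<open>R\<close> with no uniformity. So \<open>R\<close>
  and \<open>a\<close> are fixed first, by equivanishing and by continuity in time, and only then is
  the net built. Boundedness of \<open>K\<close> turns (T3) into a common bound.\<close>

lemma equivanishing_equicontinuous_imp_finite_nets:
  assumes K: "K \<subseteq> L" "Lp_bounded \<mu> p K"
    and van: "equivanishing I p \<mu> K" and cont: "equicontinuous_in_mean I J p \<mu> \<nu> T K" and e: "0 < e"
  shows "\<exists>F\<subseteq>K. finite F \<and> (\<forall>f\<in>K. \<exists>g\<in>F. nrm (\<lambda>x. f x - g x) < e)"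
proof -
  \<comment> \<open>Replacing \<open>f\<close> and \<open>g\<close> by their averages costs
    \<open>2 * e'\<close> each and the net costs \<open>e'\<close>, in all \<open>5 * e'\<close>,
    strictly below e.\<close>
  define e' where "e' = e / 6"
  have e': "0 < e'"
    using e by (simp add: e'_def)
  obtain R' where R': "0 < R'" "\<And>f. f \<in> K \<Longrightarrow> nrm (\<lambda>x. indicator {x. R' < norm x} x *\<^sub>R f x) < e'"
    using van e' unfolding equivanishing_iff by meson
  define R where "R = R' + 1"
  have R: "0 < R" "R' < R"
    using R'(1) by (auto simp: R_def)
  \<comment> \<open>Continuity in time is applied at t = 0, so any positive time bound serves; 1 is
    arbitrary.\<close>
  obtain a where a: "0 < a" "\<forall>t\<in>{-1<..<1} \<inter> J. \<forall>h. \<forall>f\<in>K. \<bar>h\<bar> \<le> a \<and> t + h \<in> J \<longrightarrow>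
      nrm (\<lambda>x. T (t + h) f x - T t f x) < e'"
    using cont[unfolded equicontinuous_in_mean_def, THEN conjunct1, rule_format, OF e' zero_less_one] by blast
  have shift: "nrm (\<lambda>x. T t f x - f x) \<le> e'" if t: "t \<in> {-a<..<a} \<inter> J" and f: "f \<in> K" for t f
  proof -
    have fL: "f \<in> L"
      using f K(1) by blast
    have "nrm (\<lambda>x. T t f x - f x) \<le> nrm (\<lambda>x. T t f x - T 0 f x) + nrm (\<lambda>x. T 0 f x - f x)"
      using t by (intro Lp_norm_diff_triangle p T_in J0 fL) auto
    also have "nrm (\<lambda>x. T 0 f x - f x) = 0"
      by (rule T_0[OF fL])
    also have "nrm (\<lambda>x. T t f x - T 0 f x) + 0 \<le> e'"
      using a(2)[rule_format, of 0 f t] t f J0 by (auto simp: abs_le_iff)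
    finally show ?thesis .
  qed
  have approx: "nrm (\<lambda>x. Av a R f x - f x) \<le> 2 * e'" if f: "f \<in> K" for f
  proof -
    have "nrm (\<lambda>x. Av a R f x - f x) \<le> e' + nrm (\<lambda>x. indicator {x. R' < norm x} x *\<^sub>R f x)"
      using f K(1) e' shift by (intro avg_approximation a R) auto
    then show ?thesis
      using R'(2)[OF f] by linarith
  qed
  obtain C where C: "0 < C" "\<forall>f\<in>L. \<forall>x\<in>I. norm (Av a R f x) \<le> C * nrm f"
    using avg_bound[OF a(1) R(1)] by blast
  obtain C0 where C0: "\<And>f. f \<in> K \<Longrightarrow> nrm f \<le> C0"
    using K(2) by (auto simp: Lp_bounded_def)
  let ?B = "{x \<in> I. norm x < R}"
  define m where "m = measure \<mu> ?B powr (1 / p)"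
  have m: "0 \<le> m"
    by (simp add: m_def)
  \<comment> \<open>Uniform accuracy that becomes at most \<open>e'\<close> in the L^p norm;
    \<open>1 + m\<close> avoids dividing by 0 when the ball is a null set.\<close>
  define c where "c = e' / (1 + m)"
  have c: "0 < c" "c * m \<le> e'"
    using e' m by (auto simp: c_def field_simps)
  have bdd: "bounded ?B"
    by (rule bounded_subset[OF bounded_ball[of 0 R]]) auto
  have bound: "norm (Av a R f x) \<le> C * C0" if "f \<in> K" "x \<in> ?B" for f x
  proof -
    have "norm (Av a R f x) \<le> C * nrm f"
      using C(2) that K(1) by auto
    also have "\<dots> \<le> C * C0"
      using C(1) C0[OF that(1)] by (intro mult_left_mono) auto
    finally show ?thesis .
  qed
  have equi: "\<exists>d>0. \<forall>f\<in>K. \<forall>x\<in>?B. \<forall>y\<in>?B. dist x y \<le> d \<longrightarrow> norm (Av a R f x - Av a R f y) < \<epsilon>"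
    if e: "0 < \<epsilon>" for \<epsilon>
  proof -
    obtain d where d: "0 < d" "\<forall>x h. \<forall>f\<in>K. norm h \<le> d \<and> x \<in> I \<and> x + h \<in> I \<and> norm x < R \<and> norm (x + h) < R \<longrightarrow>
        norm (Av a R f (x + h) - Av a R f x) < \<epsilon>"
      using cont[unfolded equicontinuous_in_mean_def, THEN conjunct2, rule_format, OF e a(1) R(1)] by blast
    have "norm (Av a R f x - Av a R f y) < \<epsilon>" if "f \<in> K" "x \<in> ?B" "y \<in> ?B" "dist x y \<le> d" for f x y
      using d(2)[rule_format, of f "x - y" y] that by (simp add: dist_norm)
    with d(1) show ?thesis
      by blast
  qed
  obtain G where G: "finite G" "G \<subseteq> K"
      "\<forall>f\<in>K. \<exists>g\<in>G. \<forall>x\<in>?B. norm (Av a R f x - Av a R g x) < c"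
    by (rule equicontinuous_finite_net[OF bdd bound c(1) equi])
  have "\<exists>g\<in>G. nrm (\<lambda>x. f x - g x) < e" if f: "f \<in> K" for f
  proof -
    obtain g where g: "g \<in> G" "\<And>x. x \<in> ?B \<Longrightarrow> norm (Av a R f x - Av a R g x) < c"
      using G(3) f by blast
    have gK: "g \<in> K"
      using g(1) G(2) by blast
    have L: "f \<in> L" "g \<in> L"
      using f gK K(1) by auto
    have AvL: "Av a R f \<in> L" "Av a R g \<in> L"
      by (rule avg_in_L[OF L(1) a(1) R(1)], rule avg_in_L[OF L(2) a(1) R(1)])
    have "nrm (\<lambda>x. Av a R f x - Av a R g x) \<le> c * m"
      unfolding m_def
    proof (rule Lp_norm_bounded_support[OF p_pos _ ball_sets ball_finite])
      show "(\<lambda>x. Av a R f x - Av a R g x) \<in> borel_measurable \<mu>"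
        by (intro borel_measurable_diff avg_measurable L)
      show "norm (Av a R f x - Av a R g x) \<le> c" if "x \<in> ?B" for x
        using g(2)[OF that] by simp
      show "Av a R f x - Av a R g x = 0" if "x \<in> space \<mu> - ?B" for x
        using that by (simp add: avg_def space_\<mu>)
    qed (use c in simp)
    moreover have "nrm (\<lambda>x. f x - g x) \<le> nrm (\<lambda>x. f x - Av a R f x) + nrm (\<lambda>x. Av a R f x - g x)"
      by (intro Lp_norm_diff_triangle p L AvL)
    moreover have "nrm (\<lambda>x. Av a R f x - g x) \<le> nrm (\<lambda>x. Av a R f x - Av a R g x) + nrm (\<lambda>x. Av a R g x - g x)"
      by (intro Lp_norm_diff_triangle p L AvL)
    ultimately have "nrm (\<lambda>x. f x - g x) \<le> 5 * e'"
      using approx[OF f] approx[OF gK] c(2) Lp_norm_minus_commute[of \<mu> p f "Av a R f"] by linarith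
    also have "\<dots> < e"
      using e by (simp add: e'_def)
    finally show ?thesis
      using g(1) by blast
  qed
  with G(1,2) show ?thesis
    by blast
qed

end

theorem theorem1:
  fixes I :: "'a::euclidean_space set" and J :: "real set"
    and \<mu> :: "'a measure" and \<nu> :: "real measure" and p :: real
    and T :: "real \<Rightarrow> ('a \<Rightarrow> 'b) \<Rightarrow> 'a \<Rightarrow> 'b::{real_normed_field,euclidean_space}"
    and K :: "('a \<Rightarrow> 'b) set"
  assumes J: "is_interval J" "J \<subseteq> {0..}" "0 \<in> J" "\<exists>t\<in>J. 0 < t"
    and p: "1 \<le> p"
    and \<mu>: "radon_measure_on I \<mu>" "finite_on_bounded \<mu>"
    and \<nu>: "radon_measure_on J \<nu>" "finite_on_bounded \<nu>"
    and \<nu>_pos: "\<And>a. 0 < a \<Longrightarrow> 0 < measure \<nu> ({-a<..<a} \<inter> J)"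
    and T: "translation I J p \<mu> \<nu> T" "bounded_translation J p \<mu> T"
      "regular_translation I J p \<mu> \<nu> T"
    and K: "K \<subseteq> Lp \<mu> p" "Lp_bounded \<mu> p K"
  shows "Lp_precompact \<mu> p K \<longleftrightarrow>
    equivanishing I p \<mu> K \<and> equicontinuous_in_mean I J p \<mu> \<nu> T K"
proof -
  interpret lp_translation I J \<mu> \<nu> p T
    using J(3) p \<mu> \<nu> \<nu>_pos T by unfold_locales (simp_all add: radon_measure_on_def)
  show ?thesis
    unfolding Lp_precompact_iff[OF p K(1)]
  proof (intro iffI conjI allI impI)
    assume net: "\<forall>e>0. \<exists>F\<subseteq>K. finite F \<and> (\<forall>f\<in>K. \<exists>g\<in>F. Lp_norm \<mu> p (\<lambda>x. f x - g x) < e)"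
    show "equivanishing I p \<mu> K"
      using net by (intro finite_nets_imp_equivanishing K) simp
    show "equicontinuous_in_mean I J p \<mu> \<nu> T K"
      using net by (intro finite_nets_imp_equicontinuous_in_mean J K) simp
  next
    fix e :: real
    assume "equivanishing I p \<mu> K \<and> equicontinuous_in_mean I J p \<mu> \<nu> T K" "0 < e"
    then show "\<exists>F\<subseteq>K. finite F \<and> (\<forall>f\<in>K. \<exists>g\<in>F. Lp_norm \<mu> p (\<lambda>x. f x - g x) < e)"
      by (intro equivanishing_equicontinuous_imp_finite_nets K) auto
  qed
qed

end
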